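(* Let $\mathcal{I}$ be the species of interval orders, and let $\mathcal{T}$ be the species of $24$-colored interval orders in which no isolated element has color $24$. There is a natural isomorphism $\mathcal{I}(24X)=E\cdot\mathcal{T}$ and, consequently, $$\mathcal{T}=E^{-1}\,\mathcal{I}(24X)$$ in the ring $\mathrm{Virt}$ of virtual species. Moreover, for every $n\ge 0$, $|\mathcal{T}[n]|=T_n$, where $T_0,T_1,T_2,\dots$ are Glaisher's T-numbers, defined by $$\sum_{n\geq 0}\frac{T_n}{(2n+1)!}\,x^{2n+1}=\frac{\sin 2x}{2\cos 3x}.$$
   Context: A species is a functor from the category of finite sets and bijections to the category of finite sets and functions; equality of species means natural isomorphism. Product: $(FG)[U]=\bigsqcup_{U=U_1\sqcup U_2}F[U_1]\times G[U_2]$. $E$ is the species of sets (exactly one structure on every finite set), $E_+$ its restriction to nonempty sets. The ring of virtual species is $\mathrm{Virt}=(\mathrm{Spe}\times\mathrm{Spe})/\!\sim$, with $(F,G)\sim(H,K)$ iff $F+K=G+H$; the class of $(F,G)$ is $F-G$, and a species $F$ is identified with $F-0$. $E^{-1}=\sum_{k\ge0}(-1)^kE_+^k$ is the multiplicative inverse of $E$ in $\mathrm{Virt}$. $\mathcal{I}[U]$ is the set of interval orders on the finite set $U$, i.e. irreflexive transitive relations on $U$ with no induced subposet isomorphic to the disjoint union of two two-element chains; transport is by relabeling. For a positive integer $c$, a $c$-colored $F$-structure on $U$ is an $F$-structure on $U$ together with a map $U\to[c]=\{1,\dots,c\}$; these form the species $F(cX)$. An element of a poset is isolated if it is comparable to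 no other element. $\mathcal{T}[n]$ denotes $\mathcal{T}[\{1,\dots,n\}]$. *)

theory Defs
  imports
    Complex_Main
    "HOL-Library.FuncSet"
    "HOL-Library.Countable_Set"
    "HOL-Computational_Algebra.Formal_Power_Series"
begin

section \<open>Species\<close>

text \<open>
  The objects of the source category are the finite subsets of the label type \<^typ>\<open>'u\<close>, its
  morphisms from \<open>U\<close> to \<open>V\<close> are the functions \<open>f\<close> with \<^term>\<open>bij_betw f U V\<close>, two functions that
  agree on \<open>U\<close> being the same morphism (this is the last clause below).  The value of a species
  at an infinite set is irrelevant.
\<close>

definition functorial :: "('u set \<Rightarrow> 's set) \<Rightarrow> ('u set \<Rightarrow> ('u \<Rightarrow> 'u) \<Rightarrow> 's \<Rightarrow> 's) \<Rightarrow> bool" where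
  "functorial S t \<longleftrightarrow>
     (\<forall>U. finite U \<longrightarrow> finite (S U)) \<and>
     (\<forall>U V f s. finite U \<longrightarrow> bij_betw f U V \<longrightarrow> s \<in> S U \<longrightarrow> t U f s \<in> S V) \<and>
     (\<forall>U s. finite U \<longrightarrow> s \<in> S U \<longrightarrow> t U (\<lambda>u. u) s = s) \<and>
     (\<forall>U V W f g s. finite U \<longrightarrow> bij_betw f U V \<longrightarrow> bij_betw g V W \<longrightarrow> s \<in> S U \<longrightarrow>
        t U (\<lambda>u. g (f u)) s = t V g (t U f s)) \<and>
     (\<forall>U V f g s. finite U \<longrightarrow> bij_betw f U V \<longrightarrow> (\<forall>u\<in>U. f u = g u) \<longrightarrow> s \<in> S U \<longrightarrow>
        t U f s = t U g s)"

lemma functorialI: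
  fixes S :: "'a set \<Rightarrow> 's set"
  assumes "\<And>U. finite U \<Longrightarrow> finite (S U)"
    and "\<And>U f s. finite U \<Longrightarrow> inj_on f U \<Longrightarrow> s \<in> S U \<Longrightarrow> t U f s \<in> S (f ` U)"
    and "\<And>U s. finite U \<Longrightarrow> s \<in> S U \<Longrightarrow> t U (\<lambda>u. u) s = s"
    and "\<And>U f g s. finite U \<Longrightarrow> inj_on f U \<Longrightarrow> inj_on g (f ` U) \<Longrightarrow> s \<in> S U \<Longrightarrow>
        t U (\<lambda>u. g (f u)) s = t (f ` U) g (t U f s)"
    and "\<And>U f g s. finite U \<Longrightarrow> inj_on f U \<Longrightarrow> (\<forall>u\<in>U. f u = g u) \<Longrightarrow> s \<in> S U \<Longrightarrow>
        t U f s = t U g s"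
  shows "functorial S t"
  unfolding functorial_def
proof (intro conjI allI impI)
  fix U V W and f g :: "'a \<Rightarrow> 'a" and s assume a: "finite U" "bij_betw f U V" "bij_betw g V W" "s \<in> S U"
  then show "t U (\<lambda>u. g (f u)) s = t V g (t U f s)"
    using assms(4)[of U f g s] by (auto simp: bij_betw_def)
next
  fix U V and f g :: "'a \<Rightarrow> 'a" and s assume a: "finite U" "bij_betw f U V" "\<forall>u\<in>U. f u = g u" "s \<in> S U"
  then show "t U f s = t U g s"
    by (intro assms(5)) (auto simp: bij_betw_def)
qed (use assms(1-3) in \<open>auto simp: bij_betw_def\<close>)

lemma functorialD:
  assumes "functorial S t" "finite U"
  shows "finite (S U)"
    and "\<And>f s. inj_on f U \<Longrightarrow> s \<in> S U \<Longrightarrow> t U f s \<in> S (f ` U)"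
    and "\<And>s. s \<in> S U \<Longrightarrow> t U (\<lambda>u. u) s = s"
    and "\<And>f g s. inj_on f U \<Longrightarrow> inj_on g (f ` U) \<Longrightarrow> s \<in> S U \<Longrightarrow>
        t U (\<lambda>u. g (f u)) s = t (f ` U) g (t U f s)"
    and "\<And>f g s. inj_on f U \<Longrightarrow> (\<forall>u\<in>U. f u = g u) \<Longrightarrow> s \<in> S U \<Longrightarrow>
        t U f s = t U g s"
proof -
  note * = assms(1)[unfolded functorial_def]
  note b = inj_on_imp_bij_betw
  show "finite (S U)" by (rule *[THEN conjunct1, rule_format, OF assms(2)])
  show "t U f s \<in> S (f ` U)" if "inj_on f U" "s \<in> S U" for f s
    by (rule *[THEN conjunct2, THEN conjunct1, rule_format, OF assms(2) b[OF that(1)] that(2)])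
  show "t U (\<lambda>u. u) s = s" if "s \<in> S U" for s
    by (rule *[THEN conjunct2, THEN conjunct2, THEN conjunct1, rule_format, OF assms(2) that])
  show "t U (\<lambda>u. g (f u)) s = t (f ` U) g (t U f s)"
    if "inj_on f U" "inj_on g (f ` U)" "s \<in> S U" for f g s
    by (rule *[THEN conjunct2, THEN conjunct2, THEN conjunct2, THEN conjunct1, rule_format,
          OF assms(2) b[OF that(1)] b[OF that(2)] that(3)])
  show "t U f s = t U g s" if "inj_on f U" "\<forall>u\<in>U. f u = g u" "s \<in> S U" for f g s
    by (rule *[THEN conjunct2, THEN conjunct2, THEN conjunct2, THEN conjunct2, rule_format,
          OF assms(2) b[OF that(1)] bspec[OF that(2)] that(3)])
qed

typedef ('u, 's) species =
  "{(S :: 'u set \<Rightarrow> 's set, t :: 'u set \<Rightarrow> ('u \<Rightarrow> 'u) \<Rightarrow> 's \<Rightarrow> 's). functorial S t}"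
  by (rule exI[of _ "(\<lambda>_. {}, \<lambda>_ _ s. s)"]) (simp add: functorial_def)

setup_lifting type_definition_species

lift_definition structures :: "('u, 's) species \<Rightarrow> 'u set \<Rightarrow> 's set" is fst .

lift_definition transport :: "('u, 's) species \<Rightarrow> 'u set \<Rightarrow> ('u \<Rightarrow> 'u) \<Rightarrow> 's \<Rightarrow> 's" is snd .

lemma functorial_species: "functorial (structures F) (transport F)"
  by transfer auto

lemmas finite_structures = functorialD(1)[OF functorial_species]
  and transport_in = functorialD(2)[OF functorial_species]
  and transport_id = functorialD(3)[OF functorial_species]
  and transport_comp = functorialD(4)[OF functorial_species]
  and transport_cong = functorialD(5)[OF functorial_species]

lemma transport_inv:
  assumes "finite U" "inj_on f U" "s \<in> structures F U"
  shows "transport F (f ` U) (inv_into U f) (transport F U f s) = s"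
proof -
  have i: "inj_on (inv_into U f) (f ` U)" by (simp add: inj_on_inv_into)
  have "transport F (f ` U) (inv_into U f) (transport F U f s) = transport F U (\<lambda>u. inv_into U f (f u)) s"
    by (rule transport_comp[where f = f and g = "inv_into U f", symmetric, OF assms(1,2) i assms(3)])
  also have "\<dots> = transport F U (\<lambda>u. u) s"
    using assms by (intro transport_cong) (auto simp: inj_on_def)
  finally show ?thesis using assms by (simp add: transport_id)
qed

lemma transport_inv':
  assumes "finite U" "inj_on f U" "s \<in> structures F (f ` U)"
  shows "transport F U f (transport F (f ` U) (inv_into U f) s) = s"
proof -
  have i: "inj_on (inv_into U f) (f ` U)" by (simp add: inj_on_inv_into)
  have e: "inv_into U f ` f ` U = U" using assms by (simp add: inv_into_image_cancel)
  have "transport F (inv_into U f ` f ` U) f (transport F (f ` U) (inv_into U f) s) =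
      transport F (f ` U) (\<lambda>u. f (inv_into U f u)) s"
    by (rule transport_comp[where f = "inv_into U f" and g = f, symmetric, OF _ i _ assms(3)])
      (simp_all only: e assms finite_imageI)
  then have "transport F U f (transport F (f ` U) (inv_into U f) s) =
      transport F (f ` U) (\<lambda>u. f (inv_into U f u)) s" by (simp only: e)
  also have "\<dots> = transport F (f ` U) (\<lambda>u. u) s"
  proof (rule transport_cong)
    show "inj_on (\<lambda>u. f (inv_into U f u)) (f ` U)"
      using assms by (auto simp: inj_on_def)
  qed (use assms in \<open>auto simp: f_inv_into_f\<close>)
  finally show ?thesis using assms by (simp add: transport_id)
qed

lemma transport_image:
  assumes "finite U" "inj_on f U"
  shows "transport F U f ` structures F U = structures F (f ` U)"
proof -
  have e: "inv_into U f ` f ` U = U" using assms by (simp add: inv_into_image_cancel)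
  have "s \<in> transport F U f ` structures F U" if "s \<in> structures F (f ` U)" for s
  proof (rule image_eqI)
    show "s = transport F U f (transport F (f ` U) (inv_into U f) s)"
      using transport_inv'[OF assms that] by simp
    show "transport F (f ` U) (inv_into U f) s \<in> structures F U"
      using transport_in[OF finite_imageI[OF assms(1)] inj_on_inv_into[OF order_refl] that] e by simp
  qed
  moreover have "transport F U f s \<in> structures F (f ` U)" if "s \<in> structures F U" for s
    by (rule transport_in[OF assms that])
  ultimately show ?thesis by blast
qed

definition nat_iso :: "('u, 's) species \<Rightarrow> ('u, 't) species \<Rightarrow> bool" (infix "\<cong>\<^sub>S" 50) where
  "F \<cong>\<^sub>S G \<longleftrightarrow> (\<exists>\<phi>.
     (\<forall>U. finite U \<longrightarrow> bij_betw (\<phi> U) (structures F U) (structures G U)) \<and>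
     (\<forall>U V f. finite U \<longrightarrow> bij_betw f U V \<longrightarrow>
        (\<forall>s\<in>structures F U. \<phi> V (transport F U f s) = transport G U f (\<phi> U s))))"

definition iso_witness ::
  "('u, 's) species \<Rightarrow> ('u, 't) species \<Rightarrow> ('u set \<Rightarrow> 's \<Rightarrow> 't) \<Rightarrow> ('u set \<Rightarrow> 't \<Rightarrow> 's) \<Rightarrow> bool" where
  "iso_witness F G \<phi> \<psi> \<longleftrightarrow>
     (\<forall>U. finite U \<longrightarrow> (\<forall>s\<in>structures F U. \<phi> U s \<in> structures G U \<and> \<psi> U (\<phi> U s) = s)) \<and>
     (\<forall>U. finite U \<longrightarrow> (\<forall>s\<in>structures G U. \<psi> U s \<in> structures F U \<and> \<phi> U (\<psi> U s) = s)) \<and>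
     (\<forall>U f. finite U \<longrightarrow> inj_on f U \<longrightarrow> (\<forall>s\<in>structures F U.
           \<phi> (f ` U) (transport F U f s) = transport G U f (\<phi> U s)))"

lemma iso_witnessD:
  assumes "iso_witness F G \<phi> \<psi>" "finite U"
  shows "s \<in> structures F U \<Longrightarrow> \<phi> U s \<in> structures G U"
    and "s \<in> structures F U \<Longrightarrow> \<psi> U (\<phi> U s) = s"
    and "t \<in> structures G U \<Longrightarrow> \<psi> U t \<in> structures F U"
    and "t \<in> structures G U \<Longrightarrow> \<phi> U (\<psi> U t) = t"
    and "inj_on f U \<Longrightarrow> s \<in> structures F U \<Longrightarrow>
      \<phi> (f ` U) (transport F U f s) = transport G U f (\<phi> U s)"
  using assms unfolding iso_witness_def by simp_all

lemma iso_witness_sym: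
  fixes F :: "('a, 's) species" and G :: "('a, 't) species"
  assumes w: "iso_witness F G \<phi> \<psi>"
  shows "iso_witness G F \<psi> \<phi>"
  unfolding iso_witness_def
proof (intro conjI allI impI ballI)
  fix U and f :: "'a \<Rightarrow> 'a" and s assume U: "finite U" "inj_on f U" "s \<in> structures G U"
  note i = iso_witnessD[OF w]
  have "\<psi> U s \<in> structures F U" "\<phi> U (\<psi> U s) = s" using i U by auto
  then show "\<psi> (f ` U) (transport G U f s) = transport F U f (\<psi> U s)"
    using i(5)[OF U(1,2), of "\<psi> U s"] i(2)[of "f ` U" "transport F U f (\<psi> U s)"]
      transport_in[of U f "\<psi> U s" F] U by simp
qed (use iso_witnessD[OF w] in auto)

lemma nat_isoI:
  assumes w: "iso_witness F G \<phi> \<psi>"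
  shows "F \<cong>\<^sub>S G"
  unfolding nat_iso_def
proof (intro exI[of _ \<phi>] conjI allI impI ballI)
  note i = iso_witnessD[OF w]
  fix U :: "'a set" assume "finite U"
  then show "bij_betw (\<phi> U) (structures F U) (structures G U)"
    by (intro bij_betw_byWitness[of _ "\<psi> U"]) (use i in auto)
qed (use iso_witnessD[OF w] in \<open>auto simp: bij_betw_def\<close>)

lemma nat_isoE:
  assumes "F \<cong>\<^sub>S G"
  obtains \<phi> \<psi> where "iso_witness F G \<phi> \<psi>"
proof -
  from assms obtain \<phi> where
    b: "\<And>U. finite U \<Longrightarrow> bij_betw (\<phi> U) (structures F U) (structures G U)" and
    n: "\<And>U V f s. finite U \<Longrightarrow> bij_betw f U V \<Longrightarrow> s \<in> structures F U \<Longrightarrow>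
           \<phi> V (transport F U f s) = transport G U f (\<phi> U s)"
    unfolding nat_iso_def by metis
  define \<psi> where "\<psi> U = inv_into (structures F U) (\<phi> U)" for U
  have "iso_witness F G \<phi> \<psi>"
    unfolding iso_witness_def \<psi>_def
  proof (intro conjI allI impI ballI, goal_cases)
    case (1 U s) then show ?case using b bij_betwE by blast
  next
    case (2 U s) then show ?case using b[of U] by (simp add: bij_betw_def)
  next
    case (3 U s) then show ?case using b[of U] by (metis bij_betw_def inv_into_into)
  next
    case (4 U s) then show ?case using b[of U] by (metis bij_betw_def f_inv_into_f)
  next
    case (5 U f s) then show ?case using n[of U f] by (simp add: bij_betw_def)
  qed
  then show thesis by (rule that)
qed

lemma nat_iso_refl: "F \<cong>\<^sub>S F"
  by (rule nat_isoI[where \<phi> = "\<lambda>_ s. s" and \<psi> = "\<lambda>_ s. s"]) (simp add: iso_witness_def)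

lemma nat_iso_sym: "F \<cong>\<^sub>S G \<Longrightarrow> G \<cong>\<^sub>S F"
  by (erule nat_isoE, drule iso_witness_sym, erule nat_isoI)

lemma nat_iso_trans [trans]:
  assumes "F \<cong>\<^sub>S G" "G \<cong>\<^sub>S H" shows "F \<cong>\<^sub>S H"
proof -
  obtain \<phi> \<psi> where w: "iso_witness F G \<phi> \<psi>" by (rule nat_isoE[OF assms(1)])
  obtain \<phi>' \<psi>' where w': "iso_witness G H \<phi>' \<psi>'" by (rule nat_isoE[OF assms(2)])
  note i = iso_witnessD[OF w] and i' = iso_witnessD[OF w']
  have "iso_witness F H (\<lambda>U s. \<phi>' U (\<phi> U s)) (\<lambda>U s. \<psi> U (\<psi>' U s))"
    unfolding iso_witness_def
  proof (intro conjI allI impI ballI, goal_cases)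
    case (1 U s) then show ?case using i(1)[OF 1] i'(1)[OF 1(1)] by blast
  next
    case (2 U s) then show ?case using i(1,2)[OF 2] i'(2)[OF 2(1)] by simp
  next
    case (3 U s) then show ?case using i'(3)[OF 3] i(3)[OF 3(1)] by blast
  next
    case (4 U s) then show ?case using i'(3,4)[OF 4] i(4)[OF 4(1)] by simp
  next
    case (5 U f s)
    then show ?case using i(5)[OF 5] i'(5)[OF 5(1,2), of "\<phi> U s"] i(1)[OF 5(1,3)] by simp
  qed
  then show ?thesis by (rule nat_isoI)
qed


subsection \<open>Operations\<close>

lift_definition species_zero :: "('u, unit) species" is "(\<lambda>_. {}, \<lambda>_ _ s. s)"
  by (simp, rule functorialI, simp_all)

lift_definition species_one :: "('u, unit) species" is
  "(\<lambda>U. if U = {} then {()} else {}, \<lambda>_ _ s. s)"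
  by (simp, rule functorialI, simp_all split: if_splits)

lemma functorial_sum:
  assumes F: "functorial S t" and G: "functorial S' t'"
  shows "functorial (\<lambda>U. S U <+> S' U) (\<lambda>U f. map_sum (t U f) (t' U f))"
proof (rule functorialI, goal_cases)
  case (1 U)
  then show ?case by (simp add: functorialD(1)[OF F] functorialD(1)[OF G])
next
  case (2 U f s)
  note * = functorialD(2)[OF F 2(1,2)] functorialD(2)[OF G 2(1,2)]
  from 2(3) show ?case by (rule PlusE) (simp_all add: * InlI InrI)
next
  case (3 U s)
  note * = functorialD(3)[OF F 3(1)] functorialD(3)[OF G 3(1)]
  from 3(2) show ?case by (rule PlusE) (simp_all add: *)
next
  case (4 U f g s)
  note * = functorialD(4)[OF F 4(1,2,3)] functorialD(4)[OF G 4(1,2,3)]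
  from 4(4) show ?case by (rule PlusE) (simp_all add: *)
next
  case (5 U f g s)
  note * = functorialD(5)[OF F 5(1,2,3)] functorialD(5)[OF G 5(1,2,3)]
  from 5(4) show ?case by (rule PlusE) (simp_all add: *)
qed

lift_definition species_sum ::
  "('u, 's) species \<Rightarrow> ('u, 't) species \<Rightarrow> ('u, 's + 't) species" (infixl "+\<^sub>S" 65) is
  "\<lambda>(S, t) (S', t'). (\<lambda>U. S U <+> S' U, \<lambda>U f. map_sum (t U f) (t' U f))"
  by (auto intro: functorial_sum)

lemma functorial_prod:
  assumes F: "functorial S t" and G: "functorial S' t'"
  shows "functorial
    (\<lambda>U. {((A, s), (B, s')). A \<union> B = U \<and> A \<inter> B = {} \<and> s \<in> S A \<and> s' \<in> S' B})
    (\<lambda>U f ((A, s), (B, s')). ((f ` A, t A f s), (f ` B, t' B f s')))"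
proof (rule functorialI, goal_cases)
  case (1 U)
  have "{((A, s), (B, s')). A \<union> B = U \<and> A \<inter> B = {} \<and> s \<in> S A \<and> s' \<in> S' B} \<subseteq>
        (SIGMA A:Pow U. S A) \<times> (SIGMA B:Pow U. S' B)" by auto
  moreover have "finite ((SIGMA A:Pow U. S A) \<times> (SIGMA B:Pow U. S' B))"
    using functorialD(1)[OF F] functorialD(1)[OF G] 1(1)
    by (intro finite_cartesian_product finite_SigmaI) (simp_all add: finite_subset)
  ultimately show ?case by (rule finite_subset)
next
  case (2 U f x)
  then obtain A s B s' where x: "x = ((A, s), (B, s'))" "U = A \<union> B" "A \<inter> B = {}" "s \<in> S A" "s' \<in> S' B"
    by auto
  with 2(1,2) have fin: "finite A" "finite B" and inj: "inj_on f A" "inj_on f B"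
    by (auto intro: inj_on_subset)
  have "f ` A \<inter> f ` B = {}" using 2(2) x(2,3) by (auto dest: inj_onD)
  then show ?case
    using functorialD(2)[OF F fin(1) inj(1) x(4)] functorialD(2)[OF G fin(2) inj(2) x(5)]
    by (simp add: x image_Un)
next
  case (3 U x)
  then obtain A s B s' where x: "x = ((A, s), (B, s'))" "U = A \<union> B" "s \<in> S A" "s' \<in> S' B"
    by auto
  with 3(1) have fin: "finite A" "finite B" by auto
  show ?case
    using functorialD(3)[OF F fin(1) x(3)] functorialD(3)[OF G fin(2) x(4)] by (simp add: x)
next
  case (4 U f g x)
  then obtain A s B s' where x: "x = ((A, s), (B, s'))" "U = A \<union> B" "s \<in> S A" "s' \<in> S' B"
    by auto
  with 4(1-3) have fin: "finite A" "finite B" and inj: "inj_on f A" "inj_on f B"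
    and inj': "inj_on g (f ` A)" "inj_on g (f ` B)"
    by (auto intro: inj_on_subset simp: image_Un)
  show ?case
    using functorialD(4)[OF F fin(1) inj(1) inj'(1) x(3)]
      functorialD(4)[OF G fin(2) inj(2) inj'(2) x(4)] by (simp add: x image_image)
next
  case (5 U f g x)
  then obtain A s B s' where x: "x = ((A, s), (B, s'))" "U = A \<union> B" "s \<in> S A" "s' \<in> S' B"
    by auto
  with 5(1-3) have fin: "finite A" "finite B" and inj: "inj_on f A" "inj_on f B"
    and eq: "\<forall>u\<in>A. f u = g u" "\<forall>u\<in>B. f u = g u"
    by (auto intro: inj_on_subset)
  have "f ` A = g ` A" "f ` B = g ` B" using eq by (auto simp: image_def)
  then show ?case
    using functorialD(5)[OF F fin(1) inj(1) eq(1) x(3)]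
      functorialD(5)[OF G fin(2) inj(2) eq(2) x(4)] by (simp add: x)
qed

text \<open>\<^term>\<open>((A, s), (B, s'))\<close> encodes the decomposition \<open>U = A \<squnion> B\<close> with \<open>s\<close> on \<open>A\<close> and \<open>s'\<close> on \<open>B\<close>.\<close>

lift_definition species_prod ::
  "('u, 's) species \<Rightarrow> ('u, 't) species \<Rightarrow> ('u, ('u set \<times> 's) \<times> ('u set \<times> 't)) species"
    (infixl "\<cdot>\<^sub>S" 70) is
  "\<lambda>(S, t) (S', t').
     (\<lambda>U. {((A, s), (B, s')). A \<union> B = U \<and> A \<inter> B = {} \<and> s \<in> S A \<and> s' \<in> S' B},
      \<lambda>U f ((A, s), (B, s')). ((f ` A, t A f s), (f ` B, t' B f s')))"
  by (auto intro!: functorial_prod[unfolded case_prod_unfold] simp: case_prod_unfold)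

text \<open>
  The sum of the family \<open>F k\<close>, \<open>k \<in> K\<close>.  The family is summable if every finite set carries only
  finitely many structures in total; the set of structures is made empty where this fails.
\<close>

lift_definition species_family_sum :: "nat set \<Rightarrow> (nat \<Rightarrow> ('u, 's) species) \<Rightarrow> ('u, nat \<times> 's) species" is
  "\<lambda>K F. (\<lambda>U. let X = (SIGMA k:K. fst (F k) U) in if finite X then X else {},
          \<lambda>U f (k, s). (k, snd (F k) U f s))"
proof -
  fix K :: "nat set" and F :: "nat \<Rightarrow> ('u set \<Rightarrow> 's set) \<times> ('u set \<Rightarrow> ('u \<Rightarrow> 'u) \<Rightarrow> 's \<Rightarrow> 's)"
  assume "\<And>k. F k \<in> {(S, t). functorial S t}"
  then have *: "functorial (fst (F k)) (snd (F k))" for k by (metis case_prodD mem_Collect_eq prod.collapse)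
  let ?X = "\<lambda>U. SIGMA k:K. fst (F k) U"
  have fin: "finite (?X (f ` U))" if "finite (?X U)" "finite U" "inj_on f U" for U f
  proof -
    have "?X (f ` U) \<subseteq> (\<lambda>(k, s). (k, snd (F k) U f s)) ` ?X U"
    proof
      fix x assume "x \<in> ?X (f ` U)"
      then obtain k s where x: "x = (k, s)" "k \<in> K" "s \<in> fst (F k) (f ` U)" by auto
      define G where "G = Abs_species (F k)"
      have G: "structures G = fst (F k)" "transport G = snd (F k)"
        using *[of k] by (simp_all add: G_def structures.rep_eq transport.rep_eq Abs_species_inverse case_prod_unfold)
      from x(3) have "s \<in> snd (F k) U f ` fst (F k) U"
        using transport_image[of U f G] that by (simp add: G)
      then show "x \<in> (\<lambda>(k, s). (k, snd (F k) U f s)) ` ?X U" using x by force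
    qed
    then show ?thesis using that(1) finite_surj by blast
  qed
  have "functorial (\<lambda>U. let X = ?X U in if finite X then X else {}) (\<lambda>U f (k, s). (k, snd (F k) U f s))"
  proof (rule functorialI, goal_cases)
    case (2 U f x)
    then obtain k s where x: "x = (k, s)" "k \<in> K" "s \<in> fst (F k) U" "finite (?X U)"
      by (auto simp: Let_def split: if_splits)
    show ?case using fin[OF x(4) 2(1,2)] functorialD(2)[OF * 2(1,2) x(3)] x
      by (simp add: Let_def)
  next
    case (3 U x)
    then obtain k s where x: "x = (k, s)" "s \<in> fst (F k) U" by (auto simp: Let_def split: if_splits)
    show ?case using functorialD(3)[OF * 3(1) x(2)] by (simp add: x)
  next
    case (4 U f g x)
    then obtain k s where x: "x = (k, s)" "s \<in> fst (F k) U" by (auto simp: Let_def split: if_splits)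
    show ?case using functorialD(4)[OF * 4(1-3) x(2)] by (simp add: x)
  next
    case (5 U f g x)
    then obtain k s where x: "x = (k, s)" "s \<in> fst (F k) U" by (auto simp: Let_def split: if_splits)
    show ?case using functorialD(5)[OF * 5(1-3) x(2)] by (simp add: x)
  qed (auto simp: Let_def)
  then show "(\<lambda>U. let X = ?X U in if finite X then X else {}, \<lambda>U f (k, s). (k, snd (F k) U f s))
    \<in> {(S, t). functorial S t}" by simp
qed

lemma functorial_plus:
  assumes F: "functorial S t"
  shows "functorial (\<lambda>U. if U = {} then {} else S U) t"
proof (rule functorialI, goal_cases)
  case (1 U)
  then show ?case by (simp add: functorialD(1)[OF F])
next
  case (2 U f s)
  then show ?case using functorialD(2)[OF F 2(1,2)] by (simp split: if_splits)
next
  case (3 U s)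
  then show ?case using functorialD(3)[OF F 3(1)] by (simp split: if_splits)
next
  case (4 U f g s)
  show ?case by (rule functorialD(4)[OF F 4(1-3)]) (use 4(4) in \<open>simp split: if_splits\<close>)
next
  case (5 U f g s)
  show ?case by (rule functorialD(5)[OF F 5(1-3)]) (use 5(4) in \<open>simp split: if_splits\<close>)
qed

lift_definition species_plus :: "('u, 's) species \<Rightarrow> ('u, 's) species" is
  "\<lambda>(S, t). (\<lambda>U. if U = {} then {} else S U, t)"
  by (auto intro: functorial_plus)

lemma functorial_colored:
  assumes F: "functorial S t"
  shows "functorial (\<lambda>U. S U \<times> (U \<rightarrow>\<^sub>E {1..c::nat}))
     (\<lambda>U f (s, \<chi>). (t U f s, restrict (\<lambda>v. \<chi> (inv_into U f v)) (f ` U)))"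
proof (rule functorialI, goal_cases)
  case (1 U)
  then show ?case by (intro finite_cartesian_product finite_PiE) (simp_all add: functorialD(1)[OF F])
next
  case (2 U f x)
  then obtain s \<chi> where x: "x = (s, \<chi>)" "s \<in> S U" "\<chi> \<in> U \<rightarrow>\<^sub>E {1..c}" by auto
  have "restrict (\<lambda>v. \<chi> (inv_into U f v)) (f ` U) \<in> f ` U \<rightarrow>\<^sub>E {1..c}"
    using PiE_mem[OF x(3) inv_into_into[of _ f U]] by (simp add: PiE_iff)
  then show ?case using functorialD(2)[OF F 2(1,2) x(2)] by (simp add: x)
next
  case (3 U x)
  then obtain s \<chi> where x: "x = (s, \<chi>)" "s \<in> S U" "\<chi> \<in> U \<rightarrow>\<^sub>E {1..c}" by auto
  have "restrict (\<lambda>v. \<chi> (inv_into U (\<lambda>u. u) v)) U = \<chi>"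
  proof
    fix v show "restrict (\<lambda>v. \<chi> (inv_into U (\<lambda>u. u) v)) U v = \<chi> v"
      using inv_into_f_f[OF inj_on_id2, of v U] PiE_arb[OF x(3), of v] by (cases "v \<in> U") simp_all
  qed
  then show ?case using functorialD(3)[OF F 3(1) x(2)] by (simp add: x)
next
  case (4 U f g x)
  then obtain s \<chi> where x: "x = (s, \<chi>)" "s \<in> S U" by auto
  have inj: "inj_on (\<lambda>u. g (f u)) U" using comp_inj_on[OF 4(2,3)] by (simp add: comp_def)
  have "restrict (\<lambda>v. \<chi> (inv_into U (\<lambda>u. g (f u)) v)) ((\<lambda>u. g (f u)) ` U) =
    restrict (\<lambda>v. restrict (\<lambda>v. \<chi> (inv_into U f v)) (f ` U) (inv_into (f ` U) g v)) (g ` f ` U)"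
  proof
    fix v
    show "restrict (\<lambda>v. \<chi> (inv_into U (\<lambda>u. g (f u)) v)) ((\<lambda>u. g (f u)) ` U) v =
    restrict (\<lambda>v. restrict (\<lambda>v. \<chi> (inv_into U f v)) (f ` U) (inv_into (f ` U) g v)) (g ` f ` U) v"
    proof (cases "v \<in> (\<lambda>u. g (f u)) ` U")
      case True
      then obtain u where "u \<in> U" "v = g (f u)" by auto
      then show ?thesis using inv_into_f_f[OF inj, of u] inv_into_f_f[OF 4(3), of "f u"]
        inv_into_f_f[OF 4(2), of u] by simp
    next
      case False
      then show ?thesis by (simp add: image_image)
    qed
  qed
  then show ?case using functorialD(4)[OF F 4(1-3) x(2)] by (simp add: x)
next
  case (5 U f g x)
  then obtain s \<chi> where x: "x = (s, \<chi>)" "s \<in> S U" by auto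
  have im: "f ` U = g ` U" using 5(3) by (auto simp: image_def)
  have inj: "inj_on g U" using inj_on_cong[of U f g] 5(2,3) by blast
  have "restrict (\<lambda>v. \<chi> (inv_into U f v)) (f ` U) = restrict (\<lambda>v. \<chi> (inv_into U g v)) (g ` U)"
    unfolding im
  proof (rule restrict_ext)
    fix v assume "v \<in> g ` U"
    then obtain u where "u \<in> U" "v = g u" by auto
    then show "\<chi> (inv_into U f v) = \<chi> (inv_into U g v)"
      using inv_into_f_f[OF 5(2), of u] inv_into_f_f[OF inj, of u] 5(3) by simp
  qed
  then show ?case using functorialD(5)[OF F 5(1-3) x(2)] by (simp add: x)
qed

text \<open>\<open>F(cX)\<close>: the map from \<open>U\<close> to \<open>{1..c}\<close> is represented by an extensional function.\<close>

lift_definition species_colored :: "('u, 's) species \<Rightarrow> nat \<Rightarrow> ('u, 's \<times> ('u \<Rightarrow> nat)) species" is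
  "\<lambda>(S, t) c. (\<lambda>U. S U \<times> (U \<rightarrow>\<^sub>E {1..c}),
     \<lambda>U f (s, \<chi>). (t U f s, restrict (\<lambda>v. \<chi> (inv_into U f v)) (f ` U)))"
  by (auto intro!: functorial_colored[unfolded case_prod_unfold One_nat_def] simp: case_prod_unfold)


lemma structures_zero [simp]: "structures species_zero U = {}"
  by transfer simp

lemma structures_one [simp]: "structures species_one U = (if U = {} then {()} else {})"
  by transfer simp

lemma structures_sum [simp]: "structures (F +\<^sub>S G) U = structures F U <+> structures G U"
  by transfer auto

lemma transport_sum [simp]: "transport (F +\<^sub>S G) U f = map_sum (transport F U f) (transport G U f)"
  by transfer auto

lemma structures_prod: "structures (F \<cdot>\<^sub>S G) U =
    {((A, s), (B, t)). A \<union> B = U \<and> A \<inter> B = {} \<and> s \<in> structures F A \<and> t \<in> structures G B}"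
  by transfer auto

lemma transport_prod [simp]: "transport (F \<cdot>\<^sub>S G) U f ((A, s), (B, t)) =
    ((f ` A, transport F A f s), (f ` B, transport G B f t))"
  by transfer auto

lemma structures_family_sum: "structures (species_family_sum K F) U =
    (if finite (SIGMA k:K. structures (F k) U) then SIGMA k:K. structures (F k) U else {})"
  by (simp add: structures.rep_eq species_family_sum.rep_eq Let_def)

lemma transport_family_sum [simp]:
  "transport (species_family_sum K F) U f (k, s) = (k, transport (F k) U f s)"
  by (simp add: transport.rep_eq species_family_sum.rep_eq)

lemma structures_plus [simp]: "structures (species_plus F) U = (if U = {} then {} else structures F U)"
  by (simp add: structures.rep_eq species_plus.rep_eq case_prod_unfold)

lemma transport_plus [simp]: "transport (species_plus F) = transport F"
  by (simp add: transport.rep_eq species_plus.rep_eq case_prod_unfold)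

lemma structures_colored: "structures (species_colored F c) U = structures F U \<times> (U \<rightarrow>\<^sub>E {1..c})"
  by (simp add: structures.rep_eq species_colored.rep_eq case_prod_unfold)

lemma transport_colored [simp]: "transport (species_colored F c) U f (s, \<chi>) =
    (transport F U f s, restrict (\<lambda>v. \<chi> (inv_into U f v)) (f ` U))"
  by (simp add: transport.rep_eq species_colored.rep_eq case_prod_unfold)

lemma structures_prodE:
  assumes "x \<in> structures (F \<cdot>\<^sub>S G) U" "finite U"
  obtains A s B t where "x = ((A, s), (B, t))" "U = A \<union> B" "A \<inter> B = {}" "finite A" "finite B"
    "s \<in> structures F A" "t \<in> structures G B"
  using assms by (auto simp: structures_prod)


subsection \<open>Arithmetic of species up to natural isomorphism\<close>

lemma sum_cong:
  assumes "F \<cong>\<^sub>S F'" "G \<cong>\<^sub>S G'"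
  shows "F +\<^sub>S G \<cong>\<^sub>S F' +\<^sub>S G'"
proof -
  obtain \<phi> \<psi> where w: "iso_witness F F' \<phi> \<psi>" by (rule nat_isoE[OF assms(1)])
  obtain \<phi>' \<psi>' where w': "iso_witness G G' \<phi>' \<psi>'" by (rule nat_isoE[OF assms(2)])
  note i = iso_witnessD[OF w] and i' = iso_witnessD[OF w']
  have "iso_witness (F +\<^sub>S G) (F' +\<^sub>S G') (\<lambda>U. map_sum (\<phi> U) (\<phi>' U)) (\<lambda>U. map_sum (\<psi> U) (\<psi>' U))"
    unfolding iso_witness_def structures_sum transport_sum
  proof (intro conjI allI impI ballI, goal_cases)
    case (1 U s) then show ?case by (auto simp: i[OF 1(1)] i'[OF 1(1)])
  next
    case (2 U s) then show ?case by (auto simp: i[OF 2(1)] i'[OF 2(1)])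
  next
    case (3 U s) then show ?case by (auto simp: i[OF 3(1)] i'[OF 3(1)])
  next
    case (4 U s) then show ?case by (auto simp: i[OF 4(1)] i'[OF 4(1)])
  next
    case (5 U f s) then show ?case by (auto simp: i(5)[OF 5(1,2)] i'(5)[OF 5(1,2)])
  qed
  then show ?thesis by (rule nat_isoI)
qed

lemma sum_comm: "F +\<^sub>S G \<cong>\<^sub>S G +\<^sub>S F"
proof (rule nat_isoI)
  show "iso_witness (F +\<^sub>S G) (G +\<^sub>S F) (\<lambda>_. case_sum Inr Inl) (\<lambda>_. case_sum Inr Inl)"
    by (auto simp: iso_witness_def)
qed

lemma sum_assoc: "(F +\<^sub>S G) +\<^sub>S H \<cong>\<^sub>S F +\<^sub>S (G +\<^sub>S H)"
proof (rule nat_isoI)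
  show "iso_witness ((F +\<^sub>S G) +\<^sub>S H) (F +\<^sub>S (G +\<^sub>S H))
     (\<lambda>_. case_sum (case_sum Inl (Inr \<circ> Inl)) (Inr \<circ> Inr))
     (\<lambda>_. case_sum (Inl \<circ> Inl) (case_sum (Inl \<circ> Inr) Inr))"
    by (auto simp: iso_witness_def)
qed

lemma sum_zero: "species_zero +\<^sub>S F \<cong>\<^sub>S F"
proof (rule nat_isoI)
  show "iso_witness (species_zero +\<^sub>S F) F (\<lambda>_. projr) (\<lambda>_. Inr)"
    by (auto simp: iso_witness_def)
qed

lemma prod_cong:
  assumes "F \<cong>\<^sub>S F'" "G \<cong>\<^sub>S G'"
  shows "F \<cdot>\<^sub>S G \<cong>\<^sub>S F' \<cdot>\<^sub>S G'"
proof -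
  obtain \<phi> \<psi> where w: "iso_witness F F' \<phi> \<psi>" by (rule nat_isoE[OF assms(1)])
  obtain \<phi>' \<psi>' where w': "iso_witness G G' \<phi>' \<psi>'" by (rule nat_isoE[OF assms(2)])
  note i = iso_witnessD[OF w] and i' = iso_witnessD[OF w']
  have "iso_witness (F \<cdot>\<^sub>S G) (F' \<cdot>\<^sub>S G')
     (\<lambda>U ((A, s), (B, t)). ((A, \<phi> A s), (B, \<phi>' B t)))
     (\<lambda>U ((A, s), (B, t)). ((A, \<psi> A s), (B, \<psi>' B t)))"
    unfolding iso_witness_def
  proof (intro conjI allI impI ballI, goal_cases)
    case (1 U x) from 1(2,1) show ?case
      by (rule structures_prodE) (use i(1-4) i'(1-4) in \<open>simp add: structures_prod\<close>)
  next
    case (2 U x) from 2(2,1) show ?case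
      by (rule structures_prodE) (use i(1-4) i'(1-4) in simp)
  next
    case (3 U x) from 3(2,1) show ?case
      by (rule structures_prodE) (use i(1-4) i'(1-4) in \<open>simp add: structures_prod\<close>)
  next
    case (4 U x) from 4(2,1) show ?case
      by (rule structures_prodE) (use i(1-4) i'(1-4) in simp)
  next
    case (5 U f x) 
    from 5(3,1) obtain A s B t where x: "x = ((A, s), (B, t))" "U = A \<union> B" "A \<inter> B = {}"
      and fin: "finite A" "finite B" and st: "s \<in> structures F A" "t \<in> structures G B"
      by (rule structures_prodE)
    have inj: "inj_on f A" "inj_on f B" using 5(2) x(2) by (auto intro: inj_on_subset)
    show ?case using i(5)[OF fin(1) inj(1) st(1)] i'(5)[OF fin(2) inj(2) st(2)] by (simp add: x)
  qed
  then show ?thesis by (rule nat_isoI)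
qed

lemma prod_comm: "F \<cdot>\<^sub>S G \<cong>\<^sub>S G \<cdot>\<^sub>S F"
proof (rule nat_isoI)
  show "iso_witness (F \<cdot>\<^sub>S G) (G \<cdot>\<^sub>S F) (\<lambda>_. prod.swap) (\<lambda>_. prod.swap)"
    unfolding iso_witness_def structures_prod by auto
qed

lemma prod_assoc: "(F \<cdot>\<^sub>S G) \<cdot>\<^sub>S H \<cong>\<^sub>S F \<cdot>\<^sub>S (G \<cdot>\<^sub>S H)"
proof (rule nat_isoI)
  show "iso_witness ((F \<cdot>\<^sub>S G) \<cdot>\<^sub>S H) (F \<cdot>\<^sub>S (G \<cdot>\<^sub>S H))
     (\<lambda>_ ((D, ((A, s), (B, t))), (C, r)). ((A, s), (B \<union> C, ((B, t), (C, r)))))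
     (\<lambda>_ ((A, s), (D, ((B, t), (C, r)))). ((A \<union> B, ((A, s), (B, t))), (C, r)))"
    unfolding iso_witness_def structures_prod by (auto simp: image_Un)
qed

lemma prod_one: "species_one \<cdot>\<^sub>S F \<cong>\<^sub>S F"
proof (rule nat_isoI)
  show "iso_witness (species_one \<cdot>\<^sub>S F) F (\<lambda>_ (x, (B, t)). t) (\<lambda>U t. (({}, ()), (U, t)))"
    unfolding iso_witness_def structures_prod by (auto split: if_splits)
qed

lemma prod_zero: "species_zero \<cdot>\<^sub>S F \<cong>\<^sub>S species_zero"
proof (rule nat_isoI)
  show "iso_witness (species_zero \<cdot>\<^sub>S F) species_zero (\<lambda>_ _. ()) (\<lambda>_ _. undefined)"
    unfolding iso_witness_def structures_prod by auto
qed

lemma prod_sum: "(F +\<^sub>S G) \<cdot>\<^sub>S H \<cong>\<^sub>S F \<cdot>\<^sub>S H +\<^sub>S G \<cdot>\<^sub>S H"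
proof (rule nat_isoI)
  show "iso_witness ((F +\<^sub>S G) \<cdot>\<^sub>S H) (F \<cdot>\<^sub>S H +\<^sub>S G \<cdot>\<^sub>S H)
     (\<lambda>_ ((A, s), y). case_sum (\<lambda>s. Inl ((A, s), y)) (\<lambda>s. Inr ((A, s), y)) s)
     (\<lambda>_. case_sum (\<lambda>((A, s), y). ((A, Inl s), y)) (\<lambda>((A, s), y). ((A, Inr s), y)))"
    unfolding iso_witness_def structures_prod structures_sum by auto
qed

text \<open>
  Cancellation: given a natural isomorphism \<open>h\<close> from \<open>F + K\<close> to \<open>G + K\<close>, apply \<open>h\<close> to an
  \<open>F\<close>-structure and keep applying it for as long as the result is a \<open>K\<close>-structure.
\<close>

inductive reach :: "('f + 'k \<Rightarrow> 'g + 'k) \<Rightarrow> 'f + 'k \<Rightarrow> 'g \<Rightarrow> bool" for h where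
  "h z = Inl y \<Longrightarrow> reach h z y"
| "h z = Inr k \<Longrightarrow> reach h (Inr k) y \<Longrightarrow> reach h z y"

lemma reach_unique: "reach h z y \<Longrightarrow> reach h z y' \<Longrightarrow> y = y'"
proof (induction rule: reach.induct)
  case (1 z y)
  from 1(2) 1(1) show ?case by (cases rule: reach.cases) simp_all
next
  case (2 z k y)
  from 2(4) have "reach h (Inr k) y'" using 2(1) by (cases rule: reach.cases) simp_all
  then show ?case by (rule 2(3))
qed

lemma reach_in:
  assumes "reach h z y" "h ` (A <+> C) \<subseteq> B <+> C" "z \<in> A <+> C"
  shows "y \<in> B"
  using assms
proof (induction rule: reach.induct)
  case (1 z y)
  then have "Inl y \<in> B <+> C" by (metis imageI subsetD)
  then show ?case by auto
next
  case (2 z k y)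
  then have "Inr k \<in> B <+> C" by (metis imageI subsetD)
  then show ?case using 2 by auto
qed

lemma reach_total:
  assumes b: "bij_betw h (A <+> C) (B <+> C)" and fin: "finite A" "finite C" and "x \<in> A"
  shows "\<exists>y. reach h (Inl x) y"
proof (rule ccontr)
  assume no: "\<nexists>y. reach h (Inl x) y"
  define N where "N = {z \<in> A <+> C. \<nexists>y. reach h z y}"
  have sub: "h ` N \<subseteq> Inr ` {k. Inr k \<in> N}"
  proof
    fix w assume "w \<in> h ` N"
    then obtain z where z: "z \<in> A <+> C" "\<nexists>y. reach h z y" "w = h z" by (auto simp: N_def)
    have w: "w \<in> B <+> C" using b z by (auto dest: bij_betwE)
    show "w \<in> Inr ` {k. Inr k \<in> N}"
    proof (cases w)
      case (Inl y) then show ?thesis using z reach.intros(1)[of h z y] by auto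
    next
      case (Inr k) then show ?thesis using z w reach.intros(2)[of h z k] by (auto simp: N_def)
    qed
  qed
  have finN: "finite N" using fin by (auto simp: N_def)
  have fin': "finite {k. Inr k \<in> N}" using fin by (auto simp: N_def intro: finite_subset[of _ C])
  have "card N = card (h ` N)"
    using b by (intro card_image[symmetric]) (auto simp: bij_betw_def N_def intro: inj_on_subset)
  also have "\<dots> \<le> card {k. Inr k \<in> N}" by (rule surj_card_le[OF fin' sub])
  also have "\<dots> = card ((Inr :: _ \<Rightarrow> 'a + _) ` {k. Inr k \<in> N})" by (rule card_image[symmetric]) simp
  also have "\<dots> < card N"
  proof (rule psubset_card_mono[OF finN])
    have "Inl x \<in> N" using no assms(4) by (auto simp: N_def)
    then show "Inr ` {k. Inr k \<in> N} \<subset> N" by blast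
  qed
  finally show False by simp
qed

lemma reach_forward:
  assumes b: "bij_betw h (A <+> C) (B <+> C)" and fin: "finite B" "finite C" and "y \<in> B"
  shows "\<exists>x\<in>A. reach h (Inl x) y"
proof -
  define g where "g = inv_into (A <+> C) h"
  have g: "bij_betw g (B <+> C) (A <+> C)" using b unfolding g_def by (rule bij_betw_inv_into)
  from reach_total[OF g fin assms(4)] obtain x where x: "reach g (Inl y) x" by blast
  have xA: "x \<in> A" using reach_in[OF x, where A = B and B = A and C = C] g assms(4) by (auto simp: bij_betw_def)
  have hg: "h (g w) = w" if "w \<in> B <+> C" for w
    using b that unfolding g_def by (metis bij_betw_def f_inv_into_f)
  have "reach h (Inl x) y" if "reach g w x" "w \<in> B <+> C"
    "case w of Inl y' \<Rightarrow> y' = y | Inr k \<Rightarrow> reach h (Inr k) y" for w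
    using that
  proof (induction rule: reach.induct)
    case (1 z x)
    then have "h (Inl x) = z" using hg by metis
    then show ?case using 1(3) by (cases z) (auto intro: reach.intros)
  next
    case (2 z k x)
    then have e: "h (Inr k) = z" using hg by metis
    have "Inr k \<in> A <+> C" using 2 g by (metis bij_betw_apply)
    moreover have "reach h (Inr k) y" using e 2(5) by (cases z) (auto intro: reach.intros)
    ultimately show ?case using 2(3) by auto
  qed
  from this[OF x] show ?thesis using xA assms(4) by auto
qed

lemma sum_cancel:
  fixes F :: "('u, 'f) species" and G :: "('u, 'g) species" and K :: "('u, 'k) species"
  assumes "F +\<^sub>S K \<cong>\<^sub>S G +\<^sub>S K"
  shows "F \<cong>\<^sub>S G"
proof -
  from assms obtain h where
    b: "\<And>U. finite U \<Longrightarrow> bij_betw (h U) (structures F U <+> structures K U) (structures G U <+> structures K U)" and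
    n: "\<And>U V f s. finite U \<Longrightarrow> bij_betw f U V \<Longrightarrow> s \<in> structures F U <+> structures K U \<Longrightarrow>
      h V (map_sum (transport F U f) (transport K U f) s) =
      map_sum (transport G U f) (transport K U f) (h U s)"
    unfolding nat_iso_def structures_sum transport_sum by metis
  define \<phi> where "\<phi> U x = (THE y. reach (h U) (Inl x) y)" for U x
  have \<phi>: "reach (h U) (Inl x) y \<longleftrightarrow> \<phi> U x = y" if "finite U" "x \<in> structures F U" for U x y
  proof -
    have "\<exists>!y. reach (h U) (Inl x) y"
      using reach_total[OF b[OF that(1)] _ _ that(2)] that reach_unique by (metis finite_structures)
    then show ?thesis unfolding \<phi>_def by (metis the_equality)
  qed
  have bij: "bij_betw (\<phi> U) (structures F U) (structures G U)" if U: "finite U" for U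
  proof -
    have fin: "finite (structures F U)" "finite (structures G U)" "finite (structures K U)"
      using U by (auto simp: finite_structures)
    have "structures G U \<subseteq> \<phi> U ` structures F U"
    proof
      fix y assume "y \<in> structures G U"
      from reach_forward[OF b[OF U] fin(2,3) this]
      obtain x where x: "x \<in> structures F U" "reach (h U) (Inl x) y" by blast
      then have "\<phi> U x = y" using \<phi>[OF U x(1)] by simp
      then show "y \<in> \<phi> U ` structures F U" using x(1) by blast
    qed
    moreover have "\<phi> U x \<in> structures G U" if "x \<in> structures F U" for x
    proof (rule reach_in)
      show "reach (h U) (Inl x) (\<phi> U x)" using \<phi>[OF U that] by simp
      show "h U ` (structures F U <+> structures K U) \<subseteq> structures G U <+> structures K U"
        using b[OF U] by (simp add: bij_betw_def)
    qed (use that in auto)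
    ultimately have im: "\<phi> U ` structures F U = structures G U" by blast
    have "card (structures F U <+> structures K U) = card (structures G U <+> structures K U)"
      using b[OF U] by (rule bij_betw_same_card)
    then have "card (structures F U) = card (structures G U)"
      using fin by (simp add: card_Plus)
    then have "inj_on (\<phi> U) (structures F U)" using im fin by (intro eq_card_imp_inj_on) auto
    then show ?thesis using im by (simp add: bij_betw_def)
  qed
  have nat: "reach (h V) (map_sum (transport F U f) (transport K U f) z) (transport G U f y)"
    if "reach (h U) z y" "z \<in> structures F U <+> structures K U" "finite U" "bij_betw f U V" for U V f z y
    using that
  proof (induction rule: reach.induct)
    case (1 z y)
    then show ?case using n[of U f V z] by (intro reach.intros(1)) simp
  next
    case (2 z k y)
    have "Inr k \<in> structures G U <+> structures K U"
      using b[of U] 2 by (metis bij_betw_apply)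
    then have k: "Inr k \<in> structures F U <+> structures K U" by auto
    show ?case
    proof (rule reach.intros(2))
      show "h V (map_sum (transport F U f) (transport K U f) z) = Inr (transport K U f k)"
        using n[of U f V z] 2 by simp
      show "reach (h V) (Inr (transport K U f k)) (transport G U f y)"
        using 2(3)[OF k 2(5,6)] by simp
    qed
  qed
  show ?thesis unfolding nat_iso_def
  proof (intro exI[of _ \<phi>] conjI allI impI ballI bij)
    fix U V :: "'u set" and f s assume a: "finite U" "bij_betw f U V" "s \<in> structures F U"
    have "reach (h U) (Inl s) (\<phi> U s)" using \<phi>[OF a(1,3)] by simp
    from nat[OF this _ a(1,2)] have "reach (h V) (Inl (transport F U f s)) (transport G U f (\<phi> U s))"
      using a by auto
    moreover have "finite V" "transport F U f s \<in> structures F V"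
      using a transport_in[of U f s F] by (auto simp: bij_betw_def)
    ultimately show "\<phi> V (transport F U f s) = transport G U f (\<phi> U s)" using \<phi> by blast
  qed
qed


section \<open>The semiring of isomorphism classes of species\<close>

text \<open>
  Every species is naturally isomorphic to one whose structures are natural numbers.  The type of
  species up to natural isomorphism can therefore be formed from the latter, whatever the type of
  structures of the species under consideration.
\<close>

lemma functorial_nat:
  assumes F: "functorial S t"
  shows "functorial (\<lambda>U. to_nat_on (S U) ` S U)
    (\<lambda>U f n. to_nat_on (S (f ` U)) (t U f (from_nat_into (S U) n)))"
proof -
  have c: "countable (S U)" if "finite U" for U by (rule countable_finite[OF functorialD(1)[OF F that]])
  have inv: "from_nat_into (S U) (to_nat_on (S U) s) = s" if "finite U" "s \<in> S U" for U s
    using c[OF that(1)] that(2) by simp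
  show ?thesis
  proof (rule functorialI, goal_cases)
    case (1 U)
    then show ?case using functorialD(1)[OF F 1] by simp
  next
    case (2 U f n)
    then obtain s where s: "s \<in> S U" "n = to_nat_on (S U) s" by auto
    show ?case using functorialD(2)[OF F 2(1,2) s(1)] inv[OF 2(1) s(1)] s(2) by simp
  next
    case (3 U n)
    then obtain s where s: "s \<in> S U" "n = to_nat_on (S U) s" by auto
    show ?case using functorialD(3)[OF F 3(1) s(1)] inv[OF 3(1) s(1)] s(2) by simp
  next
    case (4 U f g n)
    then obtain s where s: "s \<in> S U" "n = to_nat_on (S U) s" by auto
    show ?case
      using functorialD(4)[OF F 4(1-3) s(1)] inv[OF 4(1) s(1)] s(2)
        inv[OF finite_imageI[OF 4(1)] functorialD(2)[OF F 4(1,2) s(1)]] by (simp add: image_image)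
  next
    case (5 U f g n)
    then obtain s where s: "s \<in> S U" "n = to_nat_on (S U) s" by auto
    have "f ` U = g ` U" using 5(3) by (auto simp: image_def)
    then show ?case using functorialD(5)[OF F 5(1-3) s(1)] inv[OF 5(1) s(1)] s(2) by simp
  qed
qed

lift_definition species_nat :: "('u, 's) species \<Rightarrow> ('u, nat) species" is
  "\<lambda>(S, t). (\<lambda>U. to_nat_on (S U) ` S U,
     \<lambda>U f n. to_nat_on (S (f ` U)) (t U f (from_nat_into (S U) n)))"
  by (auto intro: functorial_nat)

lemma structures_nat: "structures (species_nat F) U = to_nat_on (structures F U) ` structures F U"
  by (simp add: structures.rep_eq species_nat.rep_eq case_prod_unfold)

lemma transport_nat: "transport (species_nat F) U f n =
    to_nat_on (structures F (f ` U)) (transport F U f (from_nat_into (structures F U) n))"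
  by (simp add: structures.rep_eq transport.rep_eq species_nat.rep_eq case_prod_unfold)

lemma species_nat_iso: "species_nat F \<cong>\<^sub>S F"
proof (rule nat_isoI[OF iso_witness_sym])
  have inv: "from_nat_into (structures F U) (to_nat_on (structures F U) s) = s"
    if "finite U" "s \<in> structures F U" for U s
    using countable_finite[OF finite_structures[OF that(1)], of F] that(2) by simp
  show "iso_witness F (species_nat F) (\<lambda>U. to_nat_on (structures F U)) (\<lambda>U. from_nat_into (structures F U))"
    unfolding iso_witness_def structures_nat transport_nat
    by (auto simp: inv)
qed

quotient_type 'u spe = "('u, nat) species" / nat_iso
  by (intro equivpI reflpI sympI transpI) (auto intro: nat_iso_refl nat_iso_sym nat_iso_trans)

definition iso_class :: "('u, 's) species \<Rightarrow> 'u spe" where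
  "iso_class F = abs_spe (species_nat F)"

lemma iso_class_eq_iff: "iso_class F = iso_class G \<longleftrightarrow> F \<cong>\<^sub>S G"
  unfolding iso_class_def spe.abs_eq_iff
  by (meson nat_iso_sym nat_iso_trans species_nat_iso)

lemma iso_class_rep: "iso_class (rep_spe A) = A"
proof -
  have "iso_class (rep_spe A) = abs_spe (rep_spe A)"
    unfolding iso_class_def spe.abs_eq_iff by (rule species_nat_iso)
  then show ?thesis using Quotient3_abs_rep[OF Quotient3_spe] by simp
qed

lemma iso_class_cases: obtains F :: "('u, nat) species" where "A = iso_class F"
  using iso_class_rep[of A] by metis

instantiation spe :: (type) comm_semiring_1
begin

definition zero_spe :: "'a spe" where "0 = iso_class species_zero"

definition one_spe :: "'a spe" where "1 = iso_class species_one"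

definition plus_spe :: "'a spe \<Rightarrow> 'a spe \<Rightarrow> 'a spe" where
  "A + B = iso_class (rep_spe A +\<^sub>S rep_spe B)"

definition times_spe :: "'a spe \<Rightarrow> 'a spe \<Rightarrow> 'a spe" where
  "A * B = iso_class (rep_spe A \<cdot>\<^sub>S rep_spe B)"

lemma rep_iso_class: "rep_spe (iso_class F) \<cong>\<^sub>S F"
  using iso_class_rep[of "iso_class F"] by (simp add: iso_class_eq_iff)

lemma iso_class_sum: "iso_class (F +\<^sub>S G) = iso_class F + iso_class G"
  unfolding plus_spe_def iso_class_eq_iff
  by (intro nat_iso_sym[OF sum_cong] rep_iso_class)

lemma iso_class_prod: "iso_class (F \<cdot>\<^sub>S G) = iso_class F * iso_class G"
  unfolding times_spe_def iso_class_eq_iff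
  by (intro nat_iso_sym[OF prod_cong] rep_iso_class)

instance
proof
  fix A B C :: "'a spe"
  obtain F :: "('a, nat) species" where A: "A = iso_class F" by (rule iso_class_cases)
  obtain G :: "('a, nat) species" where B: "B = iso_class G" by (rule iso_class_cases)
  obtain H :: "('a, nat) species" where C: "C = iso_class H" by (rule iso_class_cases)
  note defs = A B C zero_spe_def one_spe_def iso_class_sum[symmetric] iso_class_prod[symmetric]
    iso_class_eq_iff
  show "A + B + C = A + (B + C)" unfolding defs by (rule sum_assoc)
  show "A + B = B + A" unfolding defs by (rule sum_comm)
  show "0 + A = A" unfolding defs by (rule sum_zero)
  show "A * B * C = A * (B * C)" unfolding defs by (rule prod_assoc)
  show "A * B = B * A" unfolding defs by (rule prod_comm)
  show "1 * A = A" unfolding defs by (rule prod_one)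
  show "(A + B) * C = A * C + B * C" unfolding defs by (rule prod_sum)
  show "0 * A = 0" unfolding defs by (rule prod_zero)
  then show "A * 0 = 0" unfolding defs by (meson prod_comm nat_iso_trans)
  have "\<not> (species_zero :: ('a, unit) species) \<cong>\<^sub>S species_one"
  proof
    assume "(species_zero :: ('a, unit) species) \<cong>\<^sub>S species_one"
    then obtain \<phi> \<psi> where "iso_witness (species_zero :: ('a, unit) species) species_one \<phi> \<psi>"
      by (rule nat_isoE)
    from iso_witnessD(3)[OF this, of "{}" "()"] show False by simp
  qed
  then show "(0 :: 'a spe) \<noteq> 1" unfolding defs .
qed

end

lemma spe_add_cancel: "A + C = B + C \<longleftrightarrow> A = B" for A B C :: "'u spe"
proof
  obtain F :: "('u, nat) species" where A: "A = iso_class F" by (rule iso_class_cases)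
  obtain G :: "('u, nat) species" where B: "B = iso_class G" by (rule iso_class_cases)
  obtain H :: "('u, nat) species" where C: "C = iso_class H" by (rule iso_class_cases)
  assume "A + C = B + C"
  then show "A = B"
    unfolding A B C iso_class_sum[symmetric] iso_class_eq_iff by (rule sum_cancel)
qed simp

definition suminf_spe :: "nat set \<Rightarrow> (nat \<Rightarrow> 'u spe) \<Rightarrow> 'u spe" where
  "suminf_spe K A = iso_class (species_family_sum K (\<lambda>k. rep_spe (A k)))"


section \<open>The ring of virtual species\<close>

quotient_type 'u virt = "'u spe \<times> 'u spe" / "\<lambda>(F, G) (H, K). F + K = G + H"
proof (intro equivpI reflpI sympI transpI)
  fix x y z :: "'u spe \<times> 'u spe"
  show "(\<lambda>(F, G) (H, K). F + K = G + H) x x" by (cases x) (simp add: add.commute)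
  assume xy: "(\<lambda>(F, G) (H, K). F + K = G + H) x y"
  then show "(\<lambda>(F, G) (H, K). F + K = G + H) y x"
    by (cases x, cases y) (simp add: add.commute)
  assume yz: "(\<lambda>(F, G) (H, K). F + K = G + H) y z"
  obtain A B C D X Y where e: "x = (A, B)" "y = (C, D)" "z = (X, Y)"
    by (cases x, cases y, cases z) blast
  from xy yz e have 1: "A + D = B + C" "C + Y = D + X" by auto
  have "A + Y + (C + D) = (A + D) + (C + Y)" by (simp add: ac_simps)
  also have "\<dots> = B + X + (C + D)" unfolding 1 by (simp add: ac_simps)
  finally have "A + Y = B + X" by (simp only: spe_add_cancel)
  then show "(\<lambda>(F, G) (H, K). F + K = G + H) x z" by (simp add: e)
qed

instantiation virt :: (type) comm_ring_1
begin

lift_definition zero_virt :: "'a virt" is "(0, 0)" .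

lift_definition one_virt :: "'a virt" is "(1, 0)" .

lift_definition plus_virt :: "'a virt \<Rightarrow> 'a virt \<Rightarrow> 'a virt" is
  "\<lambda>(F, G) (H, K). (F + H, G + K)"
proof clarsimp
  fix a b c d a' b' c' d' :: "'a spe"
  assume 1: "a + d = b + c" "a' + d' = b' + c'"
  have "a + a' + (d + d') = (a + d) + (a' + d')" by (simp add: ac_simps)
  also have "\<dots> = b + b' + (c + c')" unfolding 1 by (simp add: ac_simps)
  finally show "a + a' + (d + d') = b + b' + (c + c')" .
qed

lift_definition uminus_virt :: "'a virt \<Rightarrow> 'a virt" is "\<lambda>(F, G). (G, F)"
  by auto

lift_definition minus_virt :: "'a virt \<Rightarrow> 'a virt \<Rightarrow> 'a virt" is
  "\<lambda>(F, G) (H, K). (F + K, G + H)"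
proof clarsimp
  fix a b c d a' b' c' d' :: "'a spe"
  assume 1: "a + d = b + c" "a' + d' = b' + c'"
  have "a + b' + (d + c') = (a + d) + (b' + c')" by (simp add: ac_simps)
  also have "\<dots> = b + a' + (c + d')" unfolding 1(1) 1(2)[symmetric] by (simp add: ac_simps)
  finally show "a + b' + (d + c') = b + a' + (c + d')" .
qed

lift_definition times_virt :: "'a virt \<Rightarrow> 'a virt \<Rightarrow> 'a virt" is
  "\<lambda>(F, G) (H, K). (F * H + G * K, F * K + G * H)"
proof clarsimp
  fix a b c d a' b' c' d' :: "'a spe"
  assume 1: "a + d = b + c" and 2: "a' + d' = b' + c'"
  have "(a * a' + b * b' + (c * d' + d * c')) + (c * a' + d * b' + (d * a' + c * b'))
      = (a + d) * a' + (b + c) * b' + c * (a' + d') + d * (b' + c')"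
    by (simp add: algebra_simps)
  also have "\<dots> = (b + c) * a' + (a + d) * b' + c * (b' + c') + d * (a' + d')"
    by (simp only: 1 2)
  also have "\<dots> = (a * b' + b * a' + (c * c' + d * d')) + (c * a' + d * b' + (d * a' + c * b'))"
    by (simp add: algebra_simps)
  finally show "a * a' + b * b' + (c * d' + d * c') = a * b' + b * a' + (c * c' + d * d')"
    by (simp only: spe_add_cancel)
qed

instance
proof
  fix x y z :: "'a virt"
  show "x + y + z = x + (y + z)" by transfer (auto simp: algebra_simps)
  show "x + y = y + x" by transfer (auto simp: algebra_simps)
  show "0 + x = x" by transfer (auto simp: algebra_simps)
  show "- x + x = 0" by transfer (auto simp: algebra_simps)
  show "x - y = x + - y" by transfer (auto simp: algebra_simps)
  show "x * y * z = x * (y * z)" by transfer (auto simp: algebra_simps)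
  show "x * y = y * x" by transfer (auto simp: algebra_simps)
  show "1 * x = x" by transfer (auto simp: algebra_simps)
  show "(x + y) * z = x * z + y * z" by transfer (auto simp: algebra_simps)
  show "(0 :: 'a virt) \<noteq> 1" by transfer simp
qed

end

definition spe_to_virt :: "'u spe \<Rightarrow> 'u virt" where
  "spe_to_virt A = abs_virt (A, 0)"

text \<open>The virtual species \<open>F - 0\<close> with which a species \<open>F\<close> is identified.\<close>

definition virt :: "('u, 's) species \<Rightarrow> 'u virt" where
  "virt F = spe_to_virt (iso_class F)"

lemma virt_eq_iff: "virt F = virt G \<longleftrightarrow> F \<cong>\<^sub>S G"
  by (simp add: virt_def spe_to_virt_def virt.abs_eq_iff iso_class_eq_iff)

lemma spe_to_virt_add: "spe_to_virt (A + B) = spe_to_virt A + spe_to_virt B"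
  by (simp add: spe_to_virt_def plus_virt.abs_eq)

lemma spe_to_virt_mult: "spe_to_virt (A * B) = spe_to_virt A * spe_to_virt B"
  by (simp add: spe_to_virt_def times_virt.abs_eq)

lemma spe_to_virt_one: "spe_to_virt 1 = 1"
  by (simp add: spe_to_virt_def one_virt_def)

lemma virt_prod: "virt (F \<cdot>\<^sub>S G) = virt F * virt G"
  by (simp add: virt_def iso_class_prod spe_to_virt_mult)


section \<open>The species of sets and its inverse\<close>

lift_definition species_E :: "('u, unit) species" is "(\<lambda>_. {()}, \<lambda>_ _ s. s)"
  by (simp, rule functorialI, simp_all)

lemma structures_E [simp]: "structures species_E U = {()}"
  by transfer simp

text \<open>\<open>\<Sum>\<^sub>k (- 1)\<^sup>k E\<^sub>+\<^sup>k\<close>, the even and the odd powers being collected in the two components of a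
  virtual species.\<close>

definition E_inverse :: "'u virt" where
  "E_inverse =
     spe_to_virt (suminf_spe {k. even k} (\<lambda>k. iso_class (species_plus species_E) ^ k)) -
     spe_to_virt (suminf_spe {k. odd k} (\<lambda>k. iso_class (species_plus species_E) ^ k))"

lemma family_sum_cong:
  fixes F :: "nat \<Rightarrow> ('u, 's) species" and G :: "nat \<Rightarrow> ('u, 't) species"
  assumes "\<And>k. k \<in> K \<Longrightarrow> F k \<cong>\<^sub>S G k"
  shows "species_family_sum K F \<cong>\<^sub>S species_family_sum K G"
proof -
  have "\<forall>k. \<exists>\<phi> \<psi>. k \<in> K \<longrightarrow> iso_witness (F k) (G k) \<phi> \<psi>"
    using assms nat_isoE by metis
  then obtain \<phi> \<psi> where w: "\<And>k. k \<in> K \<Longrightarrow> iso_witness (F k) (G k) (\<phi> k) (\<psi> k)" by metis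
  have fin: "finite (SIGMA k:K. structures (F k) U) \<longleftrightarrow> finite (SIGMA k:K. structures (G k) U)"
    if "finite U" for U
  proof -
    have "bij_betw (\<lambda>(k, s). (k, \<phi> k U s)) (SIGMA k:K. structures (F k) U) (SIGMA k:K. structures (G k) U)"
      by (rule bij_betw_byWitness[of _ "\<lambda>(k, s). (k, \<psi> k U s)"])
        (auto simp: iso_witnessD(1-4)[OF w that])
    then show ?thesis by (rule bij_betw_finite)
  qed
  have "iso_witness (species_family_sum K F) (species_family_sum K G)
    (\<lambda>U (k, s). (k, \<phi> k U s)) (\<lambda>U (k, s). (k, \<psi> k U s))"
    unfolding iso_witness_def structures_family_sum
  proof (intro conjI allI impI ballI, goal_cases)
    case (1 U x) then show ?case
      by (auto simp: fin[OF 1(1)] iso_witnessD(1-4)[OF w 1(1)] split: if_splits)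
  next
    case (2 U x) then show ?case
      by (auto simp: fin[OF 2(1)] iso_witnessD(1-4)[OF w 2(1)] split: if_splits)
  next
    case (3 U x) then show ?case
      by (auto simp: fin[OF 3(1)] iso_witnessD(1-4)[OF w 3(1)] split: if_splits)
  next
    case (4 U x) then show ?case
      by (auto simp: fin[OF 4(1)] iso_witnessD(1-4)[OF w 4(1)] split: if_splits)
  next
    case (5 U f x)
    then obtain k s where x: "x = (k, s)" "k \<in> K" "s \<in> structures (F k) U" by (auto split: if_splits)
    show ?case using iso_witnessD(5)[OF w[OF x(2)] 5(1,2) x(3)] by (simp add: x)
  qed
  then show ?thesis by (rule nat_isoI)
qed

definition summable_family :: "nat set \<Rightarrow> (nat \<Rightarrow> ('u, 's) species) \<Rightarrow> bool" where
  "summable_family K F \<longleftrightarrow> (\<forall>U. finite U \<longrightarrow> finite (SIGMA k:K. structures (F k) U))"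

lemma family_sum_shift:
  fixes F :: "nat \<Rightarrow> ('u, 's) species" and G :: "('u, 't) species"
  assumes sm: "summable_family K F"
  shows "G \<cdot>\<^sub>S species_family_sum K F \<cong>\<^sub>S species_family_sum (Suc ` K) (\<lambda>k. G \<cdot>\<^sub>S F (k - 1))"
proof (rule nat_isoI)
  let ?\<phi> = "\<lambda>((A :: 'u set, s :: 't), (B :: 'u set, (k, t :: 's))). (Suc k, ((A, s), (B, t)))"
  have L: "structures (species_family_sum K F) U = (SIGMA k:K. structures (F k) U)" if "finite U" for U
    using sm that by (simp add: summable_family_def structures_family_sum)
  have fin: "finite (SIGMA k:Suc ` K. structures (G \<cdot>\<^sub>S F (k - 1)) U)" if U: "finite U" for U
  proof (rule finite_surj)
    show "finite (structures (G \<cdot>\<^sub>S species_family_sum K F) U)" using U by (rule finite_structures)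
    show "(SIGMA k:Suc ` K. structures (G \<cdot>\<^sub>S F (k - 1)) U) \<subseteq>
      ?\<phi> ` structures (G \<cdot>\<^sub>S species_family_sum K F) U"
    proof
      fix x assume "x \<in> (SIGMA k:Suc ` K. structures (G \<cdot>\<^sub>S F (k - 1)) U)"
      then obtain k A s B t where x: "x = (Suc k, ((A, s), (B, t)))" "k \<in> K" "A \<union> B = U" "A \<inter> B = {}"
        "s \<in> structures G A" "t \<in> structures (F k) B"
        by (auto simp: structures_prod)
      have "finite B" using U x(3) by auto
      then have "((A, s), (B, (k, t))) \<in> structures (G \<cdot>\<^sub>S species_family_sum K F) U"
        using x by (simp add: structures_prod L)
      then show "x \<in> ?\<phi> ` structures (G \<cdot>\<^sub>S species_family_sum K F) U"
        using x(1) by (intro image_eqI) simp_all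
    qed
  qed
  have R: "structures (species_family_sum (Suc ` K) (\<lambda>k. G \<cdot>\<^sub>S F (k - 1))) U =
      (SIGMA k:Suc ` K. structures (G \<cdot>\<^sub>S F (k - 1)) U)" if "finite U" for U
    using fin[OF that] by (simp add: structures_family_sum)
  note R = R[unfolded One_nat_def]
  show "iso_witness (G \<cdot>\<^sub>S species_family_sum K F) (species_family_sum (Suc ` K) (\<lambda>k. G \<cdot>\<^sub>S F (k - 1)))
    (\<lambda>_. ?\<phi>) (\<lambda>_ (k, ((A, s), (B, t))). ((A, s), (B, (k - 1, t))))"
    unfolding iso_witness_def
  proof (intro conjI allI impI ballI, goal_cases)
    case (1 U x)
    from 1(2,1) show ?case
      by (rule structures_prodE) (use 1(1) in \<open>auto simp: L R structures_prod\<close>)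
  next
    case (2 U x)
    from 2(2,1) show ?case
      by (rule structures_prodE) (use 2(1) in \<open>auto simp: L R structures_prod\<close>)
  next
    case (3 U x)
    then show ?case by (auto simp: L R structures_prod)
  next
    case (4 U x)
    then show ?case by (auto simp: L R structures_prod)
  next
    case (5 U f x)
    from 5(3,1) show ?case
      by (rule structures_prodE) (use 5(1) in \<open>auto simp: L R structures_prod\<close>)
  qed
qed

lemma family_sum_split:
  fixes F :: "nat \<Rightarrow> ('u, 's) species"
  assumes sm: "summable_family (insert k K) F" and k: "k \<notin> K"
  shows "species_family_sum (insert k K) F \<cong>\<^sub>S F k +\<^sub>S species_family_sum K F"
proof (rule nat_isoI)
  have L: "structures (species_family_sum (insert k K) F) U = (SIGMA k:insert k K. structures (F k) U)"
    if "finite U" for U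
    using sm that by (simp add: summable_family_def structures_family_sum)
  have R: "structures (species_family_sum K F) U = (SIGMA k:K. structures (F k) U)"
    if "finite U" for U
  proof -
    have "finite (SIGMA k:K. structures (F k) U)"
      by (rule finite_subset[of _ "SIGMA k:insert k K. structures (F k) U"])
        (use sm that in \<open>auto simp: summable_family_def\<close>)
    then show ?thesis by (simp add: structures_family_sum)
  qed
  show "iso_witness (species_family_sum (insert k K) F) (F k +\<^sub>S species_family_sum K F)
    (\<lambda>_ (l, s). if l = k then Inl s else Inr (l, s))
    (\<lambda>_. case_sum (\<lambda>s. (k, s)) (\<lambda>x. x))"
    unfolding iso_witness_def structures_sum transport_sum
  proof (intro conjI allI impI ballI, goal_cases)
    case (1 U x) then show ?case by (auto simp: L R split: if_splits)
  next
    case (2 U x) then show ?case by (auto simp: L R split: if_splits)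
  next
    case (3 U x) then show ?case using k by (auto simp: L R split: if_splits)
  next
    case (4 U x) then show ?case using k by (auto simp: L R split: if_splits)
  next
    case (5 U f x) then show ?case by (auto simp: L R split: if_splits)
  qed
qed

lemma structures_plus_E_power:
  assumes "finite U" "card U < k"
  shows "structures (rep_spe (iso_class (species_plus species_E) ^ k)) U = {}"
  using assms
proof (induction k arbitrary: U)
  case 0
  then show ?case by simp
next
  case (Suc k)
  let ?P = "species_plus species_E :: ('a, unit) species"
  let ?R = "rep_spe (iso_class ?P ^ k)"
  have "iso_class ?P ^ Suc k = iso_class (?P \<cdot>\<^sub>S ?R)"
    by (simp add: iso_class_prod iso_class_rep)
  then have "rep_spe (iso_class ?P ^ Suc k) \<cong>\<^sub>S ?P \<cdot>\<^sub>S ?R" by (simp only: rep_iso_class)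
  then obtain \<phi> \<psi> where w: "iso_witness (rep_spe (iso_class ?P ^ Suc k)) (?P \<cdot>\<^sub>S ?R) \<phi> \<psi>"
    by (rule nat_isoE)
  have "structures (?P \<cdot>\<^sub>S ?R) U = {}"
  proof (rule ccontr)
    assume "structures (?P \<cdot>\<^sub>S ?R) U \<noteq> {}"
    then obtain x where "x \<in> structures (?P \<cdot>\<^sub>S ?R) U" by blast
    from this Suc(2) obtain A s B t where x: "U = A \<union> B" "A \<inter> B = {}" "finite A" "finite B"
      "s \<in> structures ?P A" "t \<in> structures ?R B" by (rule structures_prodE)
    have "A \<noteq> {}" using x(5) by auto
    then have "card A > 0" using x(3) by (simp add: card_gt_0_iff)
    moreover have "card U = card A + card B" using x(1-4) by (simp add: card_Un_disjoint)
    ultimately have "structures ?R B = {}" using Suc.IH[OF x(4)] Suc(3) by simp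
    then show False using x(6) by simp
  qed
  then show ?case using iso_witnessD(1)[OF w Suc(2)] by blast
qed

lemma summable_plus_E_power:
  "summable_family K (\<lambda>k. rep_spe (iso_class (species_plus species_E :: ('u, unit) species) ^ k))"
  unfolding summable_family_def
proof (intro allI impI)
  let ?F = "\<lambda>k. rep_spe (iso_class (species_plus species_E :: ('u, unit) species) ^ k)"
  fix U :: "'u set" assume U: "finite U"
  have "(SIGMA k:K. structures (?F k) U) \<subseteq> (SIGMA k:{..card U}. structures (?F k) U)"
    using structures_plus_E_power[OF U] by (force simp: not_less[symmetric])
  then show "finite (SIGMA k:K. structures (?F k) U)"
    by (rule finite_subset) (intro finite_SigmaI finite_atMost finite_structures U)
qed

lemma E_inverse: "virt species_E * E_inverse = (1 :: 'u virt)"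
proof -
  define P :: "'u spe" where "P = iso_class (species_plus species_E)"
  define S where "S K = suminf_spe K (\<lambda>k. P ^ k)" for K
  have E: "iso_class species_E = 1 + P"
    unfolding P_def one_spe_def iso_class_sum[symmetric] iso_class_eq_iff
  proof (rule nat_isoI)
    show "iso_witness species_E (species_one +\<^sub>S species_plus species_E)
      (\<lambda>U _. if U = {} then Inl () else Inr ()) (\<lambda>_ _. ())"
      unfolding iso_witness_def by auto
  qed
  have shift: "P * S K = S (Suc ` K)" for K
  proof -
    have "P * S K = iso_class (species_plus species_E \<cdot>\<^sub>S species_family_sum K (\<lambda>k. rep_spe (P ^ k)))"
      by (simp add: S_def suminf_spe_def P_def iso_class_prod)
    also have "\<dots> = iso_class (species_family_sum (Suc ` K)
        (\<lambda>k. species_plus species_E \<cdot>\<^sub>S rep_spe (P ^ (k - 1))))"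
      unfolding iso_class_eq_iff P_def
      by (rule family_sum_shift[OF summable_plus_E_power])
    also have "\<dots> = S (Suc ` K)"
      unfolding S_def suminf_spe_def iso_class_eq_iff
    proof (rule family_sum_cong)
      fix k assume "k \<in> Suc ` K"
      then have "P ^ k = P * P ^ (k - 1)" by auto
      also have "\<dots> = iso_class (species_plus species_E \<cdot>\<^sub>S rep_spe (P ^ (k - 1)))"
        by (simp add: iso_class_prod iso_class_rep P_def)
      finally show "species_plus species_E \<cdot>\<^sub>S rep_spe (P ^ (k - 1)) \<cong>\<^sub>S rep_spe (P ^ k)"
        by (simp add: iso_class_eq_iff[symmetric] iso_class_rep)
    qed
    finally show ?thesis .
  qed
  have split: "S (insert 0 K) = 1 + S K" if "0 \<notin> K" for K
  proof -
    have "S (insert 0 K) = iso_class (rep_spe (P ^ 0) +\<^sub>S species_family_sum K (\<lambda>k. rep_spe (P ^ k)))"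
      unfolding S_def suminf_spe_def iso_class_eq_iff P_def
      by (rule family_sum_split[OF summable_plus_E_power that])
    then show ?thesis by (simp add: iso_class_sum iso_class_rep S_def suminf_spe_def)
  qed
  have "Suc ` {k. even k} = {k. odd k}"
    by (auto simp: image_iff elim!: oddE)
  then have 1: "P * S {k. even k} = S {k. odd k}" by (simp add: shift)
  have "insert 0 (Suc ` {k. odd k}) = {k. even k}"
  proof (intro equalityI subsetI)
    fix k assume "k \<in> {k :: nat. even k}"
    then show "k \<in> insert 0 (Suc ` {k. odd k})" by (cases k) auto
  qed auto
  then have 2: "S {k. even k} = 1 + P * S {k. odd k}"
    using split[of "Suc ` {k. odd k}"] by (simp add: shift)
  have "virt species_E * E_inverse =
      spe_to_virt ((1 + P) * S {k. even k}) - spe_to_virt ((1 + P) * S {k. odd k})"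
    by (simp add: virt_def E E_inverse_def S_def P_def right_diff_distrib spe_to_virt_mult)
  also have "(1 + P) * S {k. even k} = 1 + (1 + P) * S {k. odd k}"
    by (simp add: distrib_right 1) (simp add: 2 ac_simps)
  finally show ?thesis by (simp add: spe_to_virt_add spe_to_virt_one)
qed


section \<open>Interval orders\<close>

text \<open>The last clause excludes four elements on which \<open>R\<close> induces two disjoint chains \<open>a < b\<close> and
  \<open>c < d\<close>.\<close>

definition interval_order_on :: "'u set \<Rightarrow> ('u \<times> 'u) set \<Rightarrow> bool" where
  "interval_order_on U R \<longleftrightarrow>
     R \<subseteq> U \<times> U \<and> irrefl R \<and> trans R \<and>
     (\<nexists>a b c d. distinct [a, b, c, d] \<and> R \<inter> {a, b, c, d} \<times> {a, b, c, d} = {(a, b), (c, d)})"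

lemma interval_order_on_image:
  assumes "interval_order_on U R" "inj_on f U"
  shows "interval_order_on (f ` U) (map_prod f f ` R)"
proof -
  from assms have R: "R \<subseteq> U \<times> U" "irrefl R" "trans R" and no:
    "\<nexists>a b c d. distinct [a, b, c, d] \<and> R \<inter> {a, b, c, d} \<times> {a, b, c, d} = {(a, b), (c, d)}"
    by (auto simp: interval_order_on_def)
  have inj: "x = y" if "f x = f y" "x \<in> U" "y \<in> U" for x y
    using assms(2) that by (auto dest: inj_onD)
  have iff: "(f x, f y) \<in> map_prod f f ` R \<longleftrightarrow> (x, y) \<in> R" if "x \<in> U" "y \<in> U" for x y
  proof
    assume "(f x, f y) \<in> map_prod f f ` R"
    then obtain p q where p: "(p, q) \<in> R" "f x = f p" "f y = f q" by auto
    then have "x = p" "y = q" using that R(1) inj by blast+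
    then show "(x, y) \<in> R" using p(1) by simp
  next
    assume "(x, y) \<in> R"
    then show "(f x, f y) \<in> map_prod f f ` R" by (intro image_eqI[of _ _ "(x, y)"]) simp_all
  qed
  have sub: "map_prod f f ` R \<subseteq> f ` U \<times> f ` U" using R(1) by auto
  have irr: "irrefl (map_prod f f ` R)"
    unfolding irrefl_def
  proof
    fix v show "(v, v) \<notin> map_prod f f ` R"
    proof
      assume v: "(v, v) \<in> map_prod f f ` R"
      then obtain u where "u \<in> U" "v = f u" using sub by auto
      then show False using v iff R(2) by (auto simp: irrefl_def)
    qed
  qed
  have tr: "trans (map_prod f f ` R)"
  proof (rule transI)
    fix x y z assume a: "(x, y) \<in> map_prod f f ` R" "(y, z) \<in> map_prod f f ` R"
    then obtain p q r where p: "x = f p" "y = f q" "z = f r" "p \<in> U" "q \<in> U" "r \<in> U"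
      using sub by blast
    then have "(p, q) \<in> R" "(q, r) \<in> R" using a iff by auto
    then have "(p, r) \<in> R" using R(3) by (auto dest: transD)
    then show "(x, z) \<in> map_prod f f ` R" using p iff by auto
  qed
  have "\<not> (distinct [a, b, c, d] \<and>
     map_prod f f ` R \<inter> {a, b, c, d} \<times> {a, b, c, d} = {(a, b), (c, d)})" for a b c d
  proof
    assume *: "distinct [a, b, c, d] \<and>
     map_prod f f ` R \<inter> {a, b, c, d} \<times> {a, b, c, d} = {(a, b), (c, d)}"
    then have m: "(a, b) \<in> map_prod f f ` R" "(c, d) \<in> map_prod f f ` R" by auto
    then have "a \<in> f ` U" "b \<in> f ` U" "c \<in> f ` U" "d \<in> f ` U" using sub by auto
    then obtain p q r s where p: "a = f p" "b = f q" "c = f r" "d = f s"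
      and U: "p \<in> U" "q \<in> U" "r \<in> U" "s \<in> U"
      by (elim imageE)
    have pq: "(p, q) \<in> R" "(r, s) \<in> R" using m iff U by (simp_all add: p)
    have "R \<inter> {p, q, r, s} \<times> {p, q, r, s} = {(p, q), (r, s)}"
    proof (intro equalityI subsetI)
      fix x assume x: "x \<in> R \<inter> {p, q, r, s} \<times> {p, q, r, s}"
      obtain y z where y: "x = (y, z)" "y \<in> {p, q, r, s}" "z \<in> {p, q, r, s}" "(y, z) \<in> R"
        using x by (cases x) auto
      have yz: "y \<in> U" "z \<in> U" using y U by auto
      have "(f y, f z) \<in> map_prod f f ` R" using y(4) by force
      moreover have "f y \<in> {a, b, c, d}" "f z \<in> {a, b, c, d}" using y(2,3) p by auto
      ultimately have "(f y, f z) \<in> map_prod f f ` R \<inter> {a, b, c, d} \<times> {a, b, c, d}" by blast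
      then have "(f y, f z) \<in> {(f p, f q), (f r, f s)}" using * p by metis
      then have "f y = f p \<and> f z = f q \<or> f y = f r \<and> f z = f s" by simp
      then have "y = p \<and> z = q \<or> y = r \<and> z = s" using inj yz U by blast
      then show "x \<in> {(p, q), (r, s)}" using y(1) by simp
    next
      fix x assume "x \<in> {(p, q), (r, s)}"
      then show "x \<in> R \<inter> {p, q, r, s} \<times> {p, q, r, s}" using pq by auto
    qed
    moreover have "distinct [p, q, r, s]" using * p by auto
    ultimately show False using no by blast
  qed
  then show ?thesis using sub irr tr unfolding interval_order_on_def by blast
qed

lift_definition interval_orders :: "('u, ('u \<times> 'u) set) species" is
  "(\<lambda>U. {R. interval_order_on U R}, \<lambda>U f R. map_prod f f ` R)"
proof (simp, rule functorialI, goal_cases)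
  case (1 U)
  have "{R. interval_order_on U R} \<subseteq> Pow (U \<times> U)" by (auto simp: interval_order_on_def)
  then show ?case using 1 by (auto intro: finite_subset)
next
  case (2 U f R)
  then show ?case by (simp add: interval_order_on_image)
next
  case (3 U R)
  then show ?case by (simp add: map_prod_def)
next
  case (4 U f g R)
  then show ?case by (simp add: image_image map_prod_def case_prod_unfold)
next
  case (5 U f g R)
  then have "R \<subseteq> U \<times> U" by (simp add: interval_order_on_def)
  then show ?case using 5(3) by (intro image_cong) auto
qed

lemma structures_interval_orders: "structures interval_orders U = {R. interval_order_on U R}"
  by transfer simp

lemma transport_interval_orders [simp]: "transport interval_orders U f R = map_prod f f ` R"
  by transfer simp

definition isolated :: "'u set \<Rightarrow> ('u \<times> 'u) set \<Rightarrow> 'u \<Rightarrow> bool" where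
  "isolated U R u \<longleftrightarrow> (\<forall>v\<in>U - {u}. (u, v) \<notin> R \<and> (v, u) \<notin> R)"

lemma functorial_subspecies:
  assumes S: "\<And>U. S U \<subseteq> structures F U"
    and t: "\<And>U f s. finite U \<Longrightarrow> inj_on f U \<Longrightarrow> s \<in> S U \<Longrightarrow> transport F U f s \<in> S (f ` U)"
  shows "functorial S (transport F)"
proof (rule functorialI, goal_cases)
  case (1 U)
  then show ?case using finite_subset[OF S finite_structures] by blast
next
  case (2 U f s)
  then show ?case by (rule t)
next
  case (3 U s)
  then show ?case using S[of U] by (intro transport_id) auto
next
  case (4 U f g s)
  show ?case by (rule transport_comp[OF 4(1-3)]) (use S 4(4) in blast)
next
  case (5 U f g s)
  show ?case by (rule transport_cong[OF 5(1-3)]) (use S 5(4) in blast)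
qed

lift_definition species_T :: "('u, ('u \<times> 'u) set \<times> ('u \<Rightarrow> nat)) species" is
  "(\<lambda>U. {(R, \<chi>) \<in> structures (species_colored interval_orders 24) U.
          \<forall>u\<in>U. isolated U R u \<longrightarrow> \<chi> u \<noteq> 24},
    transport (species_colored interval_orders 24))"
proof (simp, rule functorial_subspecies, goal_cases)
  case (2 U f x)
  let ?I = "species_colored interval_orders 24"
  obtain R \<chi> where x: "x = (R, \<chi>)" by (cases x)
  have mem: "transport ?I U f x \<in> structures ?I (f ` U)"
    using 2(3) by (intro transport_in[OF 2(1,2)]) auto
  have R: "R \<subseteq> U \<times> U" using 2(3)
    by (auto simp: x structures_colored structures_interval_orders interval_order_on_def)
  have "\<chi> u \<noteq> 24" if "u \<in> U" "isolated (f ` U) (map_prod f f ` R) (f u)" for u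
  proof -
    have "isolated U R u" unfolding isolated_def
    proof
      fix v assume v: "v \<in> U - {u}"
      then have "f v \<in> f ` U - {f u}" using 2(2) that(1) by (auto dest: inj_onD)
      then have "(f u, f v) \<notin> map_prod f f ` R \<and> (f v, f u) \<notin> map_prod f f ` R"
        using that(2) by (auto simp: isolated_def)
      then show "(u, v) \<notin> R \<and> (v, u) \<notin> R" by force
    qed
    then show ?thesis using 2(3) that(1) by (simp add: x)
  qed
  then show ?case using mem inv_into_f_f[OF 2(2)] by (simp add: x)
qed auto


section \<open>Glaisher's T-numbers\<close>

definition glaisher_T :: "nat \<Rightarrow> real" where
  "glaisher_T n = fact (2 * n + 1) * fps_nth (fps_sin 2 / (2 * fps_cos 3)) (2 * n + 1)"

lemma glaisher_T_generating_function:
  "Abs_fps (\<lambda>m. if odd m then glaisher_T (m div 2) / fact m else 0) = fps_sin 2 / (2 * fps_cos 3)"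
proof (rule fps_ext)
  fix m
  define G :: "real fps" where "G = fps_sin 2 / (2 * fps_cos 3)"
  have "is_unit (2 * fps_cos 3 :: real fps)" by (simp add: fps_is_unit_iff)
  then have G: "G * (2 * fps_cos 3) = fps_sin 2" by (simp add: G_def)
  have even: "fps_nth G n = 0" if "even n" for n
    using that
  proof (induction n rule: less_induct)
    case (less n)
    have "0 = fps_nth (G * (2 * fps_cos 3)) n" using less(2) by (simp add: G fps_sin_def)
    also have "G * (2 * fps_cos 3) = fps_const 2 * (G * fps_cos 3)"
      by (simp add: fps_numeral_fps_const ac_simps)
    also have "fps_nth \<dots> n = 2 * (\<Sum>i=0..n. fps_nth G i * fps_nth (fps_cos 3) (n - i))"
      by (simp only: fps_mult_left_const_nth) (simp only: fps_mult_nth)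
    also have "(\<Sum>i=0..n. fps_nth G i * fps_nth (fps_cos 3) (n - i)) =
        (\<Sum>i\<in>{n}. fps_nth G i * fps_nth (fps_cos 3) (n - i))"
    proof (rule sum.mono_neutral_right)
      show "\<forall>i\<in>{0..n} - {n}. fps_nth G i * fps_nth (fps_cos 3) (n - i) = 0"
      proof
        fix i assume i: "i \<in> {0..n} - {n}"
        show "fps_nth G i * fps_nth (fps_cos 3) (n - i) = 0"
        proof (cases "even i")
          case True then show ?thesis using less(1)[of i] i by simp
        next
          case False then show ?thesis using less(2) i by (simp add: fps_cos_def)
        qed
      qed
    qed auto
    finally show ?case by simp
  qed
  show "fps_nth (Abs_fps (\<lambda>m. if odd m then glaisher_T (m div 2) / fact m else 0)) m =
    fps_nth (fps_sin 2 / (2 * fps_cos 3)) m"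
    using even[of m] by (auto simp: glaisher_T_def G_def elim!: oddE)
qed

end

theory Submission
  imports Defs "HOL-Computational_Algebra.Polynomial"
begin

text \<open>
  The factorization \<open>\<I>(24X) = E \<cdot> \<T>\<close> holds because an isolated element takes part in no relation: the
  isolated elements of color 24 can be cut off and put back freely.  Multiplying by \<open>E\<inverse>\<close> gives
  the identity of virtual species, and taking cardinalities gives
  \<open>24\<^sup>n |\<I>[n]| = \<Sum>\<^sub>k (n choose k) |\<T>[k]|\<close>.  Since a binomial transform is injective, what is left is to
  show that the T-numbers satisfy the same relation.  It follows from two evaluations of the series
  \<open>F(t) = \<Sum>\<^sub>m (1 - q) \<dots> (1 - q\<^sup>m)\<close> with \<open>q = exp (- t)\<close>, a sum that makes sense coefficientwise because its
  \<open>m\<close>-th term is divisible by \<open>t\<^sup>m\<close>.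

  First, \<open>F\<close> is the exponential generating function of interval orders (\<open>card_interval_orders\<close>).  An
  interval order is represented in exactly one way by intervals with endpoints in \<open>{1..m}\<close> such that
  each of the \<open>m\<close> points is a left endpoint and also a right endpoint.  The set of pairs (right
  endpoint, left endpoint) that occur is a subset of a triangular array meeting every row and every
  column, and each of its cells carries a nonempty set of labels, hence the weight \<open>exp t - 1\<close>.  Removing
  the last row of the array leaves the columns met only by that row empty; with the weights \<open>s\<close> for
  met columns and \<open>v\<close> for empty ones the generating function satisfies the recursion
  \<open>row_full_sum_Suc\<close>, and along the orbit \<open>s = exp (k t)\<close>, \<open>v = exp (k t) - 1\<close> of the substitution in it, the sum
  over all \<open>m\<close> is computed by iterating a two-term relation.

  Second, \<open>exp (- t / 24) F(t) = \<Sum>\<^sub>n T\<^sub>n (t/24)\<^sup>n / n!\<close>, an identity of Zagier (\<open>zagier_identity\<close>).  Put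
  \<open>S(x) = \<Sum>\<^sub>m (1 - x)(1 - xq) \<dots> (1 - xq\<^sup>m) x\<^sup>m\<close>.  A telescoping argument gives
  \<open>S(x) = 1 - qx\<^sup>2 - q\<^sup>2x\<^sup>3 S(qx)\<close>.  For \<open>x = q\<^sup>j\<close> the coefficient of each power of \<open>t\<close> in \<open>S\<close> is a
  polynomial in \<open>j\<close>, and \<open>x \<mapsto> qx\<close> becomes \<open>j \<mapsto> j + 1\<close>.  After multiplication by
  \<open>exp (- (6j + 1)\<^sup>2 t / 24)\<close> the equation says that \<open>p(j) + p(j + 1)\<close> is a known polynomial for every such
  coefficient \<open>p\<close>, and this determines \<open>p\<close>.  The solution is the polynomial that stands for the
  divergent sum \<open>\<Sum>\<^sub>n \<chi>(n) (n + 6j)^(2k)\<close>, where \<open>\<chi>\<close> is the even primitive character modulo 12.  Its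
  derivative at \<open>j = 0\<close> is a coefficient of \<open>\<Sum>\<^sub>n \<chi>(n) exp (n y) = - sinh 2y / cosh 3y\<close>, that is, a T-number up
  to an elementary factor, whereas \<open>S(q\<^sup>j)\<close> has a factor \<open>1 - q\<^sup>j\<close>, so that its derivative at \<open>j = 0\<close>
  is \<open>t F(t)\<close>.
\<close>

unbundle fps_syntax

section \<open>Locally finite sums of power series\<close>

definition locally_finite :: "(nat \<Rightarrow> 'a::comm_ring_1 fps) \<Rightarrow> bool" where
  "locally_finite f \<longleftrightarrow> (\<forall>m. \<forall>n<m. f m $ n = 0)"

text \<open>
  The sum of a locally finite family.  The terms with index above \<open>n\<close> do not contribute to the
  \<open>n\<close>-th coefficient, so truncating each coefficient makes the sum a total operation.
\<close>

definition lsum :: "(nat \<Rightarrow> 'a::comm_ring_1 fps) \<Rightarrow> 'a fps" where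
  "lsum f = Abs_fps (\<lambda>n. \<Sum>m\<le>n. f m $ n)"

lemma lsum_nth: "lsum f $ n = (\<Sum>m\<le>n. f m $ n)"
  by (simp add: lsum_def)

lemma lsum_nth_upto:
  assumes "locally_finite f" "n \<le> N"
  shows "lsum f $ n = (\<Sum>m\<le>N. f m $ n)"
  unfolding lsum_nth
  by (rule sum.mono_neutral_left) (use assms in \<open>auto simp: locally_finite_def\<close>)

lemma lsum_cmult:
  assumes f: "locally_finite f"
  shows "lsum (\<lambda>m. c * f m) = c * lsum f"
proof (rule fps_ext)
  fix n
  have "(c * lsum f) $ n = (\<Sum>i=0..n. c $ i * (\<Sum>m\<le>n. f m $ (n - i)))"
    by (simp add: fps_mult_nth lsum_nth_upto[OF f, of _ n])
  also have "\<dots> = (\<Sum>i=0..n. \<Sum>m\<le>n. c $ i * f m $ (n - i))"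
    by (simp add: sum_distrib_left)
  also have "\<dots> = (\<Sum>m\<le>n. \<Sum>i=0..n. c $ i * f m $ (n - i))"
    by (rule sum.swap)
  finally show "lsum (\<lambda>m. c * f m) $ n = (c * lsum f) $ n"
    by (simp add: lsum_nth fps_mult_nth)
qed

lemma lsum_diff: "lsum (\<lambda>m. f m - g m) = lsum f - lsum g"
  by (rule fps_ext) (simp add: lsum_nth sum_subtractf)

lemma lsum_rec:
  assumes f: "locally_finite f"
  shows "lsum f = f 0 + lsum (\<lambda>m. f (Suc m))"
proof (rule fps_ext)
  fix n
  have "lsum f $ n = (\<Sum>m\<le>Suc n. f m $ n)"
    by (rule lsum_nth_upto[OF f]) simp
  also have "\<dots> = f 0 $ n + (\<Sum>m\<le>n. f (Suc m) $ n)"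
    by (rule sum.atMost_Suc_shift)
  finally show "lsum f $ n = (f 0 + lsum (\<lambda>m. f (Suc m))) $ n"
    by (simp add: lsum_nth)
qed

lemma locally_finite_Suc: "locally_finite f \<Longrightarrow> locally_finite (\<lambda>m. f (Suc m))"
  by (simp add: locally_finite_def)

lemma locally_finite_cmult: "locally_finite f \<Longrightarrow> locally_finite (\<lambda>m. g m * f m)"
  by (auto simp: locally_finite_def fps_mult_nth intro!: sum.neutral)

lemma vanish_mult:
  fixes f g :: "'a::comm_ring_1 fps"
  assumes "\<And>i. i < a \<Longrightarrow> f $ i = 0" "\<And>i. i < b \<Longrightarrow> g $ i = 0" "n < a + b"
  shows "(f * g) $ n = 0"
  unfolding fps_mult_nth
proof (rule sum.neutral, rule ballI)
  fix i assume "i \<in> {0..n}"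
  then have "i < a \<or> n - i < b" using assms(3) by auto
  then show "f $ i * g $ (n - i) = 0" using assms(1,2) by auto
qed

lemma locally_finite_prod:
  assumes "\<And>i. f i $ 0 = 0"
  shows "locally_finite (\<lambda>m. \<Prod>i=1..m. f i)"
  unfolding locally_finite_def
proof (intro allI impI)
  fix m n :: nat assume "n < m"
  then show "(\<Prod>i=1..m. f i) $ n = 0"
  proof (induction m arbitrary: n)
    case (Suc m)
    have "(f (Suc m) * (\<Prod>i=1..m. f i)) $ n = 0"
      by (rule vanish_mult[where a = 1 and b = m]) (use Suc assms in auto)
    then show ?case by (simp add: mult.commute)
  qed simp
qed

lemma vanish_power:
  fixes f :: "'a::comm_ring_1 fps"
  assumes "f $ 0 = 0" "n < k"
  shows "(f ^ k) $ n = 0"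
  using startsby_zero_power_prefix[OF assms(1)] assms(2) by blast

text \<open>
  Iterating the recursion \<open>N\<close> times expresses \<open>Q 0\<close> by the first \<open>N\<close> partial products and a remainder
  divisible by the \<open>N\<close>-th power of the variable; hence the recursion alone, without an initial value,
  determines \<open>Q 0\<close>.
\<close>

lemma lsum_prod_unique:
  fixes Q :: "nat \<Rightarrow> 'a::comm_ring_1 fps"
  assumes Q: "\<And>k. Q k = 1 + f (Suc k) * Q (Suc k)" and f: "\<And>k. f k $ 0 = 0"
  shows "Q 0 = lsum (\<lambda>m. \<Prod>i=1..m. f i)"
proof (rule fps_ext)
  fix n
  have *: "Q 0 = (\<Sum>m<N. \<Prod>i=1..m. f i) + (\<Prod>i=1..N. f i) * Q N" for N
  proof (induction N)
    case (Suc N)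
    show ?case unfolding Suc by (subst Q[of N]) (simp add: algebra_simps)
  qed simp
  have "Q 0 $ n = (\<Sum>m<Suc n. (\<Prod>i=1..m. f i) $ n) + ((\<Prod>i=1..Suc n. f i) * Q (Suc n)) $ n"
    by (subst *[of "Suc n"]) (simp only: fps_add_nth fps_sum_nth)
  also have "((\<Prod>i=1..Suc n. f i) * Q (Suc n)) $ n = 0"
    by (rule vanish_mult[where a = "Suc n" and b = 0])
      (use locally_finite_prod[OF f] in \<open>auto simp: locally_finite_def simp del: prod.cl_ivl_Suc\<close>)
  finally show "Q 0 $ n = lsum (\<lambda>m. \<Prod>i=1..m. f i) $ n"
    by (simp add: lsum_nth lessThan_Suc_atMost)
qed

section \<open>Surjections and sets of cells of a staircase\<close>

lemma sum_power_card_Pow: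
  fixes w :: "'a::comm_ring_1"
  assumes "finite A"
  shows "(\<Sum>X\<in>Pow A. w ^ card X) = (1 + w) ^ card A"
  using prod_add[OF assms, of "\<lambda>_. w" "\<lambda>_. 1"] by (simp add: add.commute)

text \<open>
  The exponential generating function of surjections onto \<open>S\<close>.  Every map into \<open>S\<close> is onto exactly one
  subset of \<open>S\<close>, and \<open>(exp t)^|S|\<close>, which counts all maps, is
  \<open>\<Sum>\<^sub>T (exp t - 1)^|T|\<close> over \<open>T \<subseteq> S\<close>; both sides of the claim therefore solve the same triangular system.
\<close>

lemma card_maps_onto:
  assumes U: "finite U" and "finite S"
  shows "real (card {c \<in> U \<rightarrow>\<^sub>E S. c ` U = S}) = fact (card U) * ((fps_exp 1 - 1) ^ card S) $ card U"
  using assms(2)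
proof (induction S rule: finite_psubset_induct)
  case (psubset S)
  let ?onto = "\<lambda>T. {c \<in> U \<rightarrow>\<^sub>E T. c ` U = T}"
  let ?e = "\<lambda>T. fact (card U) * ((fps_exp (1 :: real) - 1) ^ card T) $ card U"
  have fin: "finite T" if "T \<in> Pow S" for T using that psubset(1) by (auto intro: finite_subset)
  have "U \<rightarrow>\<^sub>E S = (\<Union>T\<in>Pow S. ?onto T)"
    by (auto simp: PiE_iff extensional_def)
  moreover have "card (\<Union>T\<in>Pow S. ?onto T) = (\<Sum>T\<in>Pow S. card (?onto T))"
  proof (rule card_UN_disjoint)
    show "\<forall>T\<in>Pow S. finite (?onto T)"
      using finite_PiE[OF U fin] by simp
  qed (use psubset(1) in auto)
  ultimately have "card (U \<rightarrow>\<^sub>E S) = (\<Sum>T\<in>Pow S. card (?onto T))" by (simp only:)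
  then have "(\<Sum>T\<in>Pow S. real (card (?onto T))) = real (card S) ^ card U"
    using U by (simp add: card_PiE flip: of_nat_sum)
  also have "\<dots> = fact (card U) * ((1 + (fps_exp 1 - 1)) ^ card S) $ card U"
    by (simp add: fps_exp_power_mult)
  also have "\<dots> = (\<Sum>T\<in>Pow S. ?e T)"
    unfolding sum_power_card_Pow[OF psubset(1), symmetric] fps_sum_nth sum_distrib_left ..
  finally have "(\<Sum>T\<in>Pow S. real (card (?onto T))) = (\<Sum>T\<in>Pow S. ?e T)" .
  moreover have "(\<Sum>T\<in>Pow S - {S}. real (card (?onto T))) = (\<Sum>T\<in>Pow S - {S}. ?e T)"
    by (rule sum.cong) (use psubset(2) in auto)
  ultimately show ?case
    using sum.remove[of "Pow S" S "\<lambda>T. real (card (?onto T))"] sum.remove[of "Pow S" S ?e] psubset(1)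
    by simp
qed

definition staircase :: "nat \<Rightarrow> (nat \<times> nat) set" where
  "staircase m = (SIGMA i:{1..m}. {1..i})"

definition row_full :: "nat \<Rightarrow> (nat \<times> nat) set set" where
  "row_full m = {S. S \<subseteq> staircase m \<and> fst ` S = {1..m}}"

definition row_col_full :: "nat \<Rightarrow> (nat \<times> nat) set set" where
  "row_col_full m = {S. S \<subseteq> staircase m \<and> fst ` S = {1..m} \<and> snd ` S = {1..m}}"

text \<open>
  The weight is \<open>w\<close> for each cell, \<open>s\<close> for each column that is met and \<open>v\<close> for each column that is
  not.  For \<open>s = 1\<close> and \<open>v = 0\<close> only the sets that meet every column survive.
\<close>

definition row_full_sum :: "'a::comm_ring_1 \<Rightarrow> nat \<Rightarrow> 'a \<Rightarrow> 'a \<Rightarrow> 'a" where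
  "row_full_sum w m s v =
     (\<Sum>S\<in>row_full m. w ^ card S * (s ^ card (snd ` S) * v ^ card ({1..m} - snd ` S)))"

lemma finite_staircase [simp]: "finite (staircase m)"
  by (simp add: staircase_def)

lemma finite_row_full [simp]: "finite (row_full m)"
  by (rule finite_subset[of _ "Pow (staircase m)"]) (auto simp: row_full_def)

lemma snd_row_full: "S \<in> row_full m \<Longrightarrow> snd ` S \<subseteq> {1..m}"
  by (force simp: row_full_def staircase_def)

lemma finite_row_fullD: "S \<in> row_full m \<Longrightarrow> finite S"
  by (auto simp: row_full_def intro: finite_subset)

lemma card_row_full: "S \<in> row_full m \<Longrightarrow> m \<le> card S"
  using card_image_le[OF finite_row_fullD, of S m fst] by (simp add: row_full_def)

text \<open>
  The effect of a new row \<open>T\<close> on the column weights, when \<open>C\<close> is the set of columns already met.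
  Columns contribute independently: one in \<open>C\<close> contributes \<open>s\<close> or, when \<open>T\<close> uses it, \<open>w s\<close>; any
  other contributes \<open>v\<close> or, when \<open>T\<close> uses it, \<open>w s\<close>.
\<close>

lemma sum_union_weights:
  fixes s v w :: "'a::comm_ring_1"
  assumes A: "finite A" and C: "C \<subseteq> A"
  shows "(\<Sum>T\<in>Pow A. w ^ card T * (s ^ card (C \<union> T) * v ^ card (A - (C \<union> T)))) =
     ((1 + w) * s) ^ card C * (v + w * s) ^ card (A - C)"
proof -
  have fC: "finite C" using A C by (rule finite_subset[rotated])
  have "((1 + w) * s) ^ card C * (v + w * s) ^ card (A - C) =
      (\<Prod>a\<in>C. w * s + (if a \<in> C then s else v)) * (\<Prod>a\<in>A - C. w * s + (if a \<in> C then s else v))"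
    by (simp add: algebra_simps)
  also have "\<dots> = (\<Prod>a\<in>A. w * s + (if a \<in> C then s else v))"
    using prod.subset_diff[OF C A, of "\<lambda>a. w * s + (if a \<in> C then s else v)"] by (simp add: mult.commute)
  also have "\<dots> = (\<Sum>T\<in>Pow A. (\<Prod>a\<in>T. w * s) * (\<Prod>a\<in>A - T. if a \<in> C then s else v))"
    by (rule prod_add[OF A])
  also have "\<dots> = (\<Sum>T\<in>Pow A. w ^ card T * (s ^ card (C \<union> T) * v ^ card (A - (C \<union> T))))"
  proof (rule sum.cong)
    fix T assume "T \<in> Pow A"
    then have T: "T \<subseteq> A" "finite T" using A by (auto intro: finite_subset)
    have "(\<Prod>a\<in>A - T. if a \<in> C then s else v) =
        (\<Prod>a\<in>(A - T) \<inter> C. s) * (\<Prod>a\<in>(A - T) \<inter> - C. v)"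
      using A by (simp add: prod.If_cases Collect_neg_eq)
    also have "(A - T) \<inter> C = C - T" using C by auto
    also have "(A - T) \<inter> - C = A - (C \<union> T)" by auto
    also have "(\<Prod>a\<in>C - T. s) * (\<Prod>a\<in>A - (C \<union> T). v) = s ^ card (C - T) * v ^ card (A - (C \<union> T))"
      by simp
    finally have 1: "(\<Prod>a\<in>A - T. if a \<in> C then s else v) = s ^ card (C - T) * v ^ card (A - (C \<union> T))" .
    have "card (C \<union> T) = card T + card (C - T)"
      using card_Un_disjoint[of T "C - T"] T fC by (simp add: Un_commute)
    then show "(\<Prod>a\<in>T. w * s) * (\<Prod>a\<in>A - T. if a \<in> C then s else v) =
        w ^ card T * (s ^ card (C \<union> T) * v ^ card (A - (C \<union> T)))"
      unfolding 1 by (simp add: power_mult_distrib power_add mult_ac)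
  qed simp
  finally show ?thesis by simp
qed

lemma row_full_Suc:
  "bij_betw (\<lambda>(S, T). S \<union> {Suc m} \<times> T) (row_full m \<times> (Pow {1..Suc m} - {{}})) (row_full (Suc m))"
proof (rule bij_betw_byWitness[where f' = "\<lambda>S. (S \<inter> staircase m, {j. (Suc m, j) \<in> S})"])
  have sc: "staircase (Suc m) = staircase m \<union> {Suc m} \<times> {1..Suc m}"
    by (auto simp: staircase_def le_Suc_eq)
  have no: "(Suc m, j) \<notin> staircase m" for j by (simp add: staircase_def)
  show "\<forall>x\<in>row_full m \<times> (Pow {1..Suc m} - {{}}).
     (\<lambda>S. (S \<inter> staircase m, {j. (Suc m, j) \<in> S})) ((\<lambda>(S, T). S \<union> {Suc m} \<times> T) x) = x"
    using no by (auto simp: row_full_def)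
  show "\<forall>S\<in>row_full (Suc m).
     (\<lambda>(S, T). S \<union> {Suc m} \<times> T) ((\<lambda>S. (S \<inter> staircase m, {j. (Suc m, j) \<in> S})) S) = S"
    using no by (auto simp: row_full_def sc)
  show "(\<lambda>(S, T). S \<union> {Suc m} \<times> T) ` (row_full m \<times> (Pow {1..Suc m} - {{}})) \<subseteq> row_full (Suc m)"
  proof
    fix x assume "x \<in> (\<lambda>(S, T). S \<union> {Suc m} \<times> T) ` (row_full m \<times> (Pow {1..Suc m} - {{}}))"
    then obtain S T where x: "x = S \<union> {Suc m} \<times> T" and S: "S \<in> row_full m" and T: "T \<subseteq> {1..Suc m}" "T \<noteq> {}"
      by auto
    have "fst ` x = {1..m} \<union> {Suc m}" using S T(2) by (simp add: x image_Un fst_image_times row_full_def)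
    moreover have "x \<subseteq> staircase (Suc m)" using S T(1) by (auto simp: x sc row_full_def)
    ultimately show "x \<in> row_full (Suc m)" by (auto simp: row_full_def)
  qed
  show "(\<lambda>S. (S \<inter> staircase m, {j. (Suc m, j) \<in> S})) ` row_full (Suc m) \<subseteq>
     row_full m \<times> (Pow {1..Suc m} - {{}})"
  proof
    fix x assume "x \<in> (\<lambda>S. (S \<inter> staircase m, {j. (Suc m, j) \<in> S})) ` row_full (Suc m)"
    then obtain S where S: "S \<in> row_full (Suc m)" and x: "x = (S \<inter> staircase m, {j. (Suc m, j) \<in> S})" by auto
    have row: "\<exists>j. (i, j) \<in> S" if "i \<in> {1..Suc m}" for i
    proof -
      have "i \<in> fst ` S" using S that by (simp add: row_full_def)
      then show ?thesis by force
    qed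
    have "i \<in> fst ` (S \<inter> staircase m)" if i: "i \<in> {1..m}" for i
    proof -
      obtain j where "(i, j) \<in> S" using row[of i] i by auto
      then have "(i, j) \<in> S \<inter> staircase m" using S i by (auto simp: row_full_def sc)
      then show ?thesis by force
    qed
    moreover have "fst ` (S \<inter> staircase m) \<subseteq> {1..m}" by (auto simp: staircase_def)
    ultimately have "fst ` (S \<inter> staircase m) = {1..m}" by blast
    moreover have "{j. (Suc m, j) \<in> S} \<noteq> {}" using row[of "Suc m"] by auto
    moreover have "{j. (Suc m, j) \<in> S} \<subseteq> {1..Suc m}"
      using S no by (auto simp: row_full_def sc)
    ultimately show "x \<in> row_full m \<times> (Pow {1..Suc m} - {{}})"
      by (auto simp: x row_full_def)
  qed
qed

text \<open>
  A set of cells of the staircase of size \<open>m + 1\<close> is one of size \<open>m\<close> together with its last row, and the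
  last column contains no cell outside that row.  The first term sums over arbitrary last rows, the
  second one takes the empty last row away.
\<close>

lemma row_full_sum_Suc:
  "row_full_sum w (Suc m) s v =
     (v + w * s) * row_full_sum w m ((1 + w) * s) (v + w * s) - v * row_full_sum w m s v"
proof -
  let ?A = "{1..Suc m}"
  let ?g = "\<lambda>S T. w ^ card T * (s ^ card (snd ` S \<union> T) * v ^ card (?A - (snd ` S \<union> T)))"
  have inner: "(\<Sum>T\<in>Pow ?A - {{}}. w ^ card (S \<union> {Suc m} \<times> T) *
       (s ^ card (snd ` (S \<union> {Suc m} \<times> T)) * v ^ card (?A - snd ` (S \<union> {Suc m} \<times> T)))) =
      w ^ card S * (((1 + w) * s) ^ card (snd ` S) * (v + w * s) ^ card ({1..m} - snd ` S)) * (v + w * s) -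
      w ^ card S * (s ^ card (snd ` S) * v ^ card ({1..m} - snd ` S)) * v"
    if S: "S \<in> row_full m" for S
  proof -
    let ?C = "snd ` S"
    have C: "?C \<subseteq> {1..m}" by (rule snd_row_full[OF S])
    have d: "card (?A - ?C) = Suc (card ({1..m} - ?C))"
    proof -
      have "?A - ?C = insert (Suc m) ({1..m} - ?C)" using C by auto
      then show ?thesis by simp
    qed
    have "(\<Sum>T\<in>Pow ?A - {{}}. w ^ card (S \<union> {Suc m} \<times> T) *
       (s ^ card (snd ` (S \<union> {Suc m} \<times> T)) * v ^ card (?A - snd ` (S \<union> {Suc m} \<times> T)))) =
       (\<Sum>T\<in>Pow ?A - {{}}. w ^ card S * ?g S T)"
    proof (rule sum.cong)
      fix T assume "T \<in> Pow ?A - {{}}"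
      then have "finite T" by (auto intro: finite_subset)
      moreover have "S \<inter> {Suc m} \<times> T = {}" using S by (auto simp: row_full_def staircase_def)
      ultimately have "card (S \<union> {Suc m} \<times> T) = card S + card T"
        using finite_row_fullD[OF S] by (simp add: card_Un_disjoint card_cartesian_product)
      moreover have "snd ` (S \<union> {Suc m} \<times> T) = ?C \<union> T" by (simp add: image_Un)
      ultimately show "w ^ card (S \<union> {Suc m} \<times> T) *
         (s ^ card (snd ` (S \<union> {Suc m} \<times> T)) * v ^ card (?A - snd ` (S \<union> {Suc m} \<times> T))) =
         w ^ card S * ?g S T" by (simp add: power_add mult.assoc)
    qed simp
    also have "\<dots> = w ^ card S * ((\<Sum>T\<in>Pow ?A. ?g S T) - ?g S {})"
    proof -
      have "(\<Sum>T\<in>Pow ?A. ?g S T) = ?g S {} + (\<Sum>T\<in>Pow ?A - {{}}. ?g S T)"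
        by (rule sum.remove) auto
      then show ?thesis by (simp only: sum_distrib_left[symmetric] add_diff_cancel_left')
    qed
    also have "(\<Sum>T\<in>Pow ?A. ?g S T) = ((1 + w) * s) ^ card ?C * (v + w * s) ^ card (?A - ?C)"
      by (rule sum_union_weights) (use C in auto)
    finally show ?thesis
      by (simp only: Un_empty_right card.empty power_0 mult_1 d power_Suc) (simp add: algebra_simps)
  qed
  have "row_full_sum w (Suc m) s v =
      (\<Sum>(S, T)\<in>row_full m \<times> (Pow ?A - {{}}). w ^ card (S \<union> {Suc m} \<times> T) *
       (s ^ card (snd ` (S \<union> {Suc m} \<times> T)) * v ^ card (?A - snd ` (S \<union> {Suc m} \<times> T))))"
    unfolding row_full_sum_def
    by (subst sum.reindex_bij_betw[OF row_full_Suc, symmetric]) (simp add: case_prod_unfold)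
  also have "\<dots> = (\<Sum>S\<in>row_full m. \<Sum>T\<in>Pow ?A - {{}}. w ^ card (S \<union> {Suc m} \<times> T) *
       (s ^ card (snd ` (S \<union> {Suc m} \<times> T)) * v ^ card (?A - snd ` (S \<union> {Suc m} \<times> T))))"
    by (rule sum.cartesian_product[symmetric])
  also have "\<dots> = (\<Sum>S\<in>row_full m.
      w ^ card S * (((1 + w) * s) ^ card (snd ` S) * (v + w * s) ^ card ({1..m} - snd ` S)) * (v + w * s) -
      w ^ card S * (s ^ card (snd ` S) * v ^ card ({1..m} - snd ` S)) * v)"
    by (rule sum.cong[OF refl inner])
  finally show ?thesis
    unfolding row_full_sum_def sum_subtractf sum_distrib_right[symmetric] by (simp only: mult.commute)
qed

lemma row_full_sum_0: "row_full_sum w 0 s v = 1"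
proof -
  have "row_full 0 = {{}}" by (auto simp: row_full_def staircase_def)
  then show ?thesis by (simp add: row_full_sum_def)
qed

lemma row_full_sum_1_0: "row_full_sum w m 1 0 = (\<Sum>S\<in>row_col_full m. w ^ card S)"
proof -
  have "(\<Sum>S\<in>row_col_full m. w ^ card S) =
      (\<Sum>S\<in>row_col_full m. w ^ card S * (1 ^ card (snd ` S) * 0 ^ card ({1..m} - snd ` S)))"
    by (rule sum.cong) (auto simp: row_col_full_def)
  also have "\<dots> = row_full_sum w m 1 0"
    unfolding row_full_sum_def
  proof (rule sum.mono_neutral_left)
    show "\<forall>S\<in>row_full m - row_col_full m. w ^ card S * (1 ^ card (snd ` S) * 0 ^ card ({1..m} - snd ` S)) = 0"
    proof
      fix S assume "S \<in> row_full m - row_col_full m"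
      then have "{1..m} - snd ` S \<noteq> {}" using snd_row_full[of S m] by (auto simp: row_full_def row_col_full_def)
      then have "card ({1..m} - snd ` S) \<noteq> 0" by simp
      then show "w ^ card S * (1 ^ card (snd ` S) * 0 ^ card ({1..m} - snd ` S)) = 0"
        by (simp add: power_0_left)
    qed
  qed (auto simp: row_full_def row_col_full_def)
  finally show ?thesis ..
qed

text \<open>
  The substitution \<open>(s, v) \<mapsto> ((1 + w) s, v + w s)\<close> of the recursion maps \<open>(exp (k t), exp (k t) - 1)\<close> to
  \<open>(exp ((k + 1) t), exp ((k + 1) t) - 1)\<close> when \<open>1 + w = exp t\<close>.  Summed over all sizes and normalized by \<open>exp (k t)\<close>, it becomes
  the recursion that is solved by the sum of products.
\<close>

lemma lsum_row_col_full:
  "lsum (\<lambda>m. \<Sum>S\<in>row_col_full m. (fps_exp 1 - 1) ^ card S) = lsum (\<lambda>m. \<Prod>i=1..m. 1 - fps_exp (- real i))"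
proof -
  define w where "w = (fps_exp 1 - 1 :: real fps)"
  define P where "P k m = row_full_sum w m (fps_exp (real k)) (fps_exp (real k) - 1)" for k m
  have lf: "locally_finite (P k)" for k
    unfolding locally_finite_def
  proof (intro allI impI)
    fix m n :: nat assume n: "n < m"
    have "(w ^ card S * X) $ n = 0" if "S \<in> row_full m" for S X
    proof (rule vanish_mult[where a = m and b = 0])
      show "(w ^ card S) $ i = 0" if "i < m" for i
        using card_row_full[OF \<open>S \<in> row_full m\<close>] that by (intro vanish_power) (auto simp: w_def)
    qed (use n in auto)
    then show "P k m $ n = 0" by (simp add: P_def row_full_sum_def fps_sum_nth)
  qed
  have step: "P k (Suc m) = (fps_exp (real (Suc k)) - 1) * P (Suc k) m - (fps_exp (real k) - 1) * P k m" for k m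
  proof -
    have "(1 + w) * fps_exp (real k) = fps_exp (real (Suc k))"
      by (simp add: w_def fps_exp_add_mult)
    moreover from this have "fps_exp (real k) - 1 + w * fps_exp (real k) = fps_exp (real (Suc k)) - 1"
      by (simp add: algebra_simps)
    ultimately show ?thesis unfolding P_def row_full_sum_Suc by (simp only:)
  qed
  define Q where "Q k = fps_exp (real k) * lsum (P k)" for k
  have "Q k = 1 + (1 - fps_exp (- real (Suc k))) * Q (Suc k)" for k
  proof -
    have "lsum (P k) = 1 + lsum (\<lambda>m. (fps_exp (real (Suc k)) - 1) * P (Suc k) m - (fps_exp (real k) - 1) * P k m)"
      using lsum_rec[OF lf[of k]] by (simp only: step) (simp add: P_def row_full_sum_0)
    also have "\<dots> = 1 + ((fps_exp (real (Suc k)) - 1) * lsum (P (Suc k)) - (fps_exp (real k) - 1) * lsum (P k))"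
      by (simp only: lsum_diff lsum_cmult[OF lf])
    finally have "Q k = 1 + (fps_exp (real (Suc k)) - 1) * lsum (P (Suc k))"
      by (simp add: Q_def algebra_simps)
    also have "fps_exp (real (Suc k)) - 1 = (1 - fps_exp (- real (Suc k))) * fps_exp (real (Suc k))"
      by (simp add: left_diff_distrib flip: fps_exp_add_mult)
    finally show ?thesis by (simp only: Q_def mult.assoc)
  qed
  from lsum_prod_unique[of Q "\<lambda>i. 1 - fps_exp (- real i)", OF this]
  have 1: "Q 0 = lsum (\<lambda>m. \<Prod>i=1..m. 1 - fps_exp (- real i))" by simp
  have 2: "Q 0 = lsum (\<lambda>m. \<Sum>S\<in>row_col_full m. (fps_exp 1 - 1) ^ card S)"
    by (simp add: Q_def P_def[abs_def] row_full_sum_1_0 w_def)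
  show ?thesis by (rule trans[OF sym[OF 2] 1])
qed

section \<open>Counting interval orders\<close>

definition down_set :: "('u \<times> 'u) set \<Rightarrow> 'u \<Rightarrow> 'u set" where
  "down_set R v = {u. (u, v) \<in> R}"

text \<open>
  The down sets of an interval order form a chain \<open>D\<^sub>1 \<subset> \<dots> \<subset> D\<^sub>m\<close>.  The first component, the right
  endpoint of \<open>u\<close>, is the largest index \<open>i\<close> with \<open>u \<notin> D\<^sub>i\<close>; the second one, the left endpoint, is the
  index of the down set of \<open>u\<close>.  Both are counted from 1.
\<close>

definition endpoints :: "'u set \<Rightarrow> ('u \<times> 'u) set \<Rightarrow> 'u \<Rightarrow> nat \<times> nat" where
  "endpoints U R = restrict (\<lambda>u.
     (card {D \<in> down_set R ` U. u \<notin> D}, card {D \<in> down_set R ` U. D \<subseteq> down_set R u})) U"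

definition order_of_endpoints :: "'u set \<Rightarrow> ('u \<Rightarrow> nat \<times> nat) \<Rightarrow> ('u \<times> 'u) set" where
  "order_of_endpoints U c = {(u, v) \<in> U \<times> U. fst (c u) < snd (c v)}"

text \<open>
  If \<open>a\<close> lies only below \<open>v\<close> and \<open>c\<close> only below \<open>w\<close>, then \<open>a < v\<close> and \<open>c < w\<close> form two disjoint chains.
\<close>

lemma down_sets_chain:
  assumes "interval_order_on U R"
  shows "down_set R v \<subseteq> down_set R w \<or> down_set R w \<subseteq> down_set R v"
proof (rule ccontr)
  assume "\<not> ?thesis"
  then obtain a c where ac: "(a, v) \<in> R" "(a, w) \<notin> R" "(c, w) \<in> R" "(c, v) \<notin> R"
    by (auto simp: down_set_def)
  have irr: "(x, x) \<notin> R" for x using assms by (simp add: interval_order_on_def irrefl_def)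
  have tr: "(x, z) \<in> R" if "(x, y) \<in> R" "(y, z) \<in> R" for x y z
    using assms that by (auto simp: interval_order_on_def dest: transD)
  have "distinct [a, v, c, w]" using ac irr tr by auto
  moreover have "R \<inter> {a, v, c, w} \<times> {a, v, c, w} = {(a, v), (c, w)}"
  proof -
    have "(a, c) \<notin> R" "(v, a) \<notin> R" "(v, c) \<notin> R" "(v, w) \<notin> R"
      "(c, a) \<notin> R" "(w, a) \<notin> R" "(w, v) \<notin> R" "(w, c) \<notin> R"
      using ac irr tr by blast+
    then show ?thesis using ac irr by blast
  qed
  ultimately show False using assms unfolding interval_order_on_def by blast
qed

text \<open>
  Both components are sizes of initial segments of the chain of down sets, so they compare as these
  segments do: the down sets that avoid \<open>u\<close> are among those contained in the down set of \<open>v\<close>,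
  and the down set of \<open>v\<close> is a further one, if and only if it contains \<open>u\<close>.
\<close>

lemma endpoints_less_iff:
  assumes R: "interval_order_on U R" and U: "finite U" and uv: "u \<in> U" "v \<in> U"
  shows "fst (endpoints U R u) < snd (endpoints U R v) \<longleftrightarrow> (u, v) \<in> R"
proof -
  let ?A = "{D \<in> down_set R ` U. u \<notin> D}" and ?B = "{D \<in> down_set R ` U. D \<subseteq> down_set R v}"
  have fin: "finite ?A" "finite ?B" using U by auto
  have "card ?A < card ?B \<longleftrightarrow> u \<in> down_set R v"
  proof
    assume u: "u \<in> down_set R v"
    have "?A \<subseteq> ?B" using u down_sets_chain[OF R, of _ v] by blast
    moreover have "down_set R v \<in> ?B - ?A" using u uv by auto
    ultimately show "card ?A < card ?B" using fin by (intro psubset_card_mono) auto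
  next
    assume "card ?A < card ?B"
    then have "\<not> ?B \<subseteq> ?A" using card_mono[OF fin(1), of ?B] by auto
    then show "u \<in> down_set R v" by auto
  qed
  then show ?thesis using uv by (simp add: endpoints_def down_set_def)
qed

lemma order_of_endpoints_endpoints:
  assumes R: "interval_order_on U R" and U: "finite U"
  shows "order_of_endpoints U (endpoints U R) = R"
proof -
  have "R \<subseteq> U \<times> U" using R by (simp add: interval_order_on_def)
  then show ?thesis using endpoints_less_iff[OF R U] by (auto simp: order_of_endpoints_def)
qed

text \<open>
  Ranking the chain of down sets is injective, so all \<open>m\<close> left endpoints occur.  The right endpoint
  \<open>j < m\<close> is that of any element which enters the chain between the down sets number \<open>j\<close> and \<open>j + 1\<close>;
  the right endpoint \<open>m\<close> belongs to an element with the largest down set.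
\<close>

lemma endpoints_row_col_full:
  assumes R: "interval_order_on U R" and U: "finite U"
  shows "endpoints U R ` U \<in> row_col_full (card (down_set R ` U))"
proof -
  let ?D = "down_set R ` U" and ?c = "endpoints U R"
  define m where "m = card ?D"
  define rank where "rank D = card {D' \<in> ?D. D' \<subseteq> D}" for D
  have fin: "finite ?D" using U by simp
  have snd: "snd (?c u) = rank (down_set R u)" if "u \<in> U" for u
    using that by (simp add: endpoints_def rank_def)
  have irr: "(u, u) \<notin> R" for u using R by (simp add: interval_order_on_def irrefl_def)
  have RU: "R \<subseteq> U \<times> U" using R by (simp add: interval_order_on_def)
  have rank_mono: "rank D < rank D'" if "D \<subset> D'" "D' \<in> ?D" for D D'
    unfolding rank_def by (rule psubset_card_mono) (use that fin in auto)
  have inj: "inj_on rank ?D"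
  proof (rule inj_onI)
    fix D D' assume D: "D \<in> ?D" "D' \<in> ?D" "rank D = rank D'"
    then have "D \<subseteq> D' \<or> D' \<subseteq> D" using down_sets_chain[OF R] by blast
    then show "D = D'" using D rank_mono[of D D'] rank_mono[of D' D] by (metis less_irrefl psubsetI)
  qed
  have range: "1 \<le> rank D \<and> rank D \<le> m" if "D \<in> ?D" for D
  proof -
    have "{D' \<in> ?D. D' \<subseteq> D} \<noteq> {}" using that by auto
    then have "rank D \<noteq> 0" using fin by (simp add: rank_def)
    moreover have "rank D \<le> m" unfolding rank_def m_def by (rule card_mono[OF fin]) auto
    ultimately show ?thesis by simp
  qed
  have "rank ` ?D = {1..m}"
  proof (rule card_subset_eq)
    show "card (rank ` ?D) = card {1..m}" by (simp add: card_image[OF inj] m_def)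
  qed (use range in auto)
  then have snds: "snd ` ?c ` U = {1..m}" using snd by (simp add: image_image)
  have le: "snd (?c u) \<le> fst (?c u)" if "u \<in> U" for u
    using endpoints_less_iff[OF R U that that] irr by (simp add: not_less)
  have fst_le: "fst (?c u) \<le> m" if "u \<in> U" for u
    using that by (simp add: endpoints_def m_def card_mono[OF fin])
  have sub: "?c ` U \<subseteq> staircase m"
  proof
    fix x assume "x \<in> ?c ` U"
    then obtain u where u: "u \<in> U" "x = ?c u" by auto
    have "1 \<le> snd (?c u)" using u snds by auto
    then show "x \<in> staircase m" using le[OF u(1)] fst_le[OF u(1)] u(2)
      by (cases "?c u") (auto simp: staircase_def)
  qed
  have "j \<in> fst ` ?c ` U" if j: "j \<in> {1..m}" for j
  proof -
    obtain v where v: "v \<in> U" "snd (?c v) = j" using snds j by (metis (no_types, lifting) imageE)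
    show ?thesis
    proof (cases "j = m")
      case True
      then have "fst (?c v) = j" using le[OF v(1)] fst_le[OF v(1)] v(2) by simp
      then show ?thesis using v(1) by force
    next
      case False
      \<comment> \<open>\<open>v\<close> and \<open>w\<close> have consecutive down sets; an element of the second that is not in the first
        has right endpoint \<open>j\<close>\<close>
      then have "Suc j \<in> {1..m}" using j by auto
      then obtain w where w: "w \<in> U" "snd (?c w) = Suc j" using snds by (metis (no_types, lifting) imageE)
      have "\<not> down_set R w \<subseteq> down_set R v"
      proof
        assume "down_set R w \<subseteq> down_set R v"
        then have "rank (down_set R w) \<le> rank (down_set R v)"
          unfolding rank_def by (intro card_mono) (use fin in auto)
        then show False using v w snd by simp
      qed
      then obtain u where u: "(u, w) \<in> R" "(u, v) \<notin> R" by (auto simp: down_set_def)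
      then have "u \<in> U" using RU by auto
      then have "fst (?c u) < Suc j" "\<not> fst (?c u) < j"
        using endpoints_less_iff[OF R U] u v w by metis+
      then have "fst (?c u) = j" by simp
      then show ?thesis using \<open>u \<in> U\<close> by force
    qed
  qed
  moreover have "fst ` ?c ` U \<subseteq> {1..m}"
    using sub by (auto simp: staircase_def)
  ultimately have "fst ` ?c ` U = {1..m}" by blast
  then show ?thesis using sub snds by (simp add: row_col_full_def m_def)
qed

text \<open>
  If \<open>a < b\<close> and \<open>x < y\<close>, and \<open>a\<close> does not end after \<open>x\<close>, then \<open>a\<close> lies to the left of \<open>y\<close> as well;
  so there are no two disjoint chains.
\<close>

lemma interval_order_of_endpoints:
  assumes le: "\<And>u. u \<in> U \<Longrightarrow> snd (c u) \<le> fst (c u)"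
  shows "interval_order_on U (order_of_endpoints U c)"
proof -
  let ?R = "order_of_endpoints U c"
  have "irrefl ?R" using le by (auto simp: irrefl_def order_of_endpoints_def dest: leD)
  moreover have "trans ?R"
    by (rule transI) (use le in \<open>force simp: order_of_endpoints_def\<close>)
  moreover have "\<not> (distinct [a, b, x, y] \<and> ?R \<inter> {a, b, x, y} \<times> {a, b, x, y} = {(a, b), (x, y)})"
    for a b x y
  proof
    assume *: "distinct [a, b, x, y] \<and> ?R \<inter> {a, b, x, y} \<times> {a, b, x, y} = {(a, b), (x, y)}"
    then have ab: "(a, b) \<in> ?R" "(x, y) \<in> ?R" by auto
    have "(a, y) \<notin> ?R"
    proof
      assume "(a, y) \<in> ?R"
      then have "(a, y) \<in> {(a, b), (x, y)}" using * by blast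
      then show False using * by auto
    qed
    moreover have "(x, b) \<notin> ?R"
    proof
      assume "(x, b) \<in> ?R"
      then have "(x, b) \<in> {(a, b), (x, y)}" using * by blast
      then show False using * by auto
    qed
    ultimately show False using ab by (auto simp: order_of_endpoints_def)
  qed
  ultimately show ?thesis
    unfolding interval_order_on_def by (auto simp: order_of_endpoints_def)
qed

text \<open>
  The down sets are the sets \<open>P j\<close> of all elements ending before \<open>j\<close>.  They are strictly increasing in
  \<open>j\<close> because every \<open>j\<close> is a right endpoint, and all of them occur because every \<open>j\<close> is a left
  endpoint; so counting down sets recovers the endpoints.
\<close>

lemma endpoints_order_of_endpoints:
  assumes c: "c \<in> extensional U" "c ` U \<in> row_col_full m"
  shows "endpoints U (order_of_endpoints U c) = c"
proof -
  let ?R = "order_of_endpoints U c"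
  define P where "P j = {u \<in> U. fst (c u) < j}" for j
  have P: "down_set ?R v = P (snd (c v))" if "v \<in> U" for v
    using that by (auto simp: down_set_def order_of_endpoints_def P_def)
  have fsts: "fst ` c ` U = {1..m}" and snds: "snd ` c ` U = {1..m}"
    using c(2) by (auto simp: row_col_full_def)
  have D: "down_set ?R ` U = P ` {1..m}"
    unfolding snds[symmetric] image_image using P by (intro image_cong) auto
  have mono: "P j \<subseteq> P k \<longleftrightarrow> j \<le> k" if jk: "j \<in> {1..m}" "k \<in> {1..m}" for j k
  proof
    assume sub: "P j \<subseteq> P k"
    show "j \<le> k"
    proof (rule ccontr)
      assume "\<not> j \<le> k"
      moreover obtain u where "u \<in> U" "fst (c u) = k" using fsts jk(2) by (metis (no_types, lifting) imageE)
      ultimately have "u \<in> P j - P k" by (auto simp: P_def)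
      then show False using sub by blast
    qed
  qed (auto simp: P_def)
  have inj: "inj_on P {1..m}"
    by (rule inj_onI) (use mono in \<open>metis order_antisym order_refl\<close>)
  have "endpoints U ?R u = c u" if u: "u \<in> U" for u
  proof -
    have cu: "fst (c u) \<in> {1..m}" "snd (c u) \<in> {1..m}" using fsts snds u by auto
    have "{D \<in> P ` {1..m}. u \<notin> D} = P ` {1..fst (c u)}"
      using cu u by (auto simp: P_def)
    moreover have "{D \<in> P ` {1..m}. D \<subseteq> P (snd (c u))} = P ` {1..snd (c u)}"
    proof -
      have "{D \<in> P ` {1..m}. D \<subseteq> P (snd (c u))} = P ` {j \<in> {1..m}. P j \<subseteq> P (snd (c u))}"
        by blast
      also have "{j \<in> {1..m}. P j \<subseteq> P (snd (c u))} = {j \<in> {1..m}. j \<le> snd (c u)}"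
        using mono[OF _ cu(2)] by blast
      also have "\<dots> = {1..snd (c u)}" using cu(2) by auto
      finally show ?thesis .
    qed
    moreover have "card (P ` {1..j}) = j" if "j \<in> {1..m}" for j
      using card_image[OF inj_on_subset[OF inj, of "{1..j}"]] that by simp
    ultimately show ?thesis
      using cu u by (simp add: endpoints_def D P[OF u])
  qed
  moreover have "endpoints U ?R u = c u" if "u \<notin> U" for u
    using that c(1) by (simp add: endpoints_def extensional_def)
  ultimately show ?thesis by blast
qed

lemma endpoints_extensional: "endpoints U R \<in> extensional U"
  by (simp add: endpoints_def)

lemma bij_betw_endpoints:
  assumes U: "finite U"
  shows "bij_betw (endpoints U) {R. interval_order_on U R}
    {c \<in> extensional U. \<exists>m. c ` U \<in> row_col_full m}"
proof (rule bij_betw_byWitness[where f' = "order_of_endpoints U"])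
  show "\<forall>R\<in>{R. interval_order_on U R}. order_of_endpoints U (endpoints U R) = R"
    using order_of_endpoints_endpoints[OF _ U] by simp
  show "\<forall>c\<in>{c \<in> extensional U. \<exists>m. c ` U \<in> row_col_full m}. endpoints U (order_of_endpoints U c) = c"
    using endpoints_order_of_endpoints by blast
  show "endpoints U ` {R. interval_order_on U R} \<subseteq> {c \<in> extensional U. \<exists>m. c ` U \<in> row_col_full m}"
    using endpoints_row_col_full[OF _ U] endpoints_extensional by blast
  show "order_of_endpoints U ` {c \<in> extensional U. \<exists>m. c ` U \<in> row_col_full m} \<subseteq> {R. interval_order_on U R}"
  proof clarify
    fix c m assume "c ` U \<in> row_col_full m"
    then have "c u \<in> staircase m" if "u \<in> U" for u using that by (auto simp: row_col_full_def)
    then show "interval_order_on U (order_of_endpoints U c)"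
      by (intro interval_order_of_endpoints) (force simp: staircase_def)
  qed
qed

text \<open>
  Sort the interval orders by the set \<open>S\<close> of endpoint pairs that occur.  The orders with a given \<open>S\<close>
  are the maps of \<open>U\<close> onto \<open>S\<close>, and \<open>S\<close> has \<open>m \<le> |U|\<close> rows, since each of them is met.
\<close>

lemma card_interval_orders:
  assumes U: "finite U"
  shows "real (card {R. interval_order_on U R}) =
    fact (card U) * lsum (\<lambda>m. \<Prod>i=1..m. 1 - fps_exp (- real i)) $ card U"
proof -
  let ?onto = "\<lambda>S :: (nat \<times> nat) set. {c \<in> U \<rightarrow>\<^sub>E S. c ` U = S}"
  have finS: "finite S" if "S \<in> row_col_full m" for S m
    using that by (auto simp: row_col_full_def intro: finite_subset)
  have fin: "finite (row_col_full m)" for m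
    by (rule finite_subset[of _ "Pow (staircase m)"]) (auto simp: row_col_full_def)
  define I where "I = (\<Union>m\<in>{..card U}. row_col_full m)"
  have "{c \<in> extensional U. \<exists>m. c ` U \<in> row_col_full m} = (\<Union>S\<in>I. ?onto S)"
  proof (intro equalityI subsetI)
    fix c assume "c \<in> {c \<in> extensional U. \<exists>m. c ` U \<in> row_col_full m}"
    then obtain m where c: "c \<in> extensional U" and m: "c ` U \<in> row_col_full m" by blast
    have "m = card (fst ` c ` U)" using m by (simp add: row_col_full_def)
    also have "\<dots> \<le> card U" using card_image_le[OF U, of "fst \<circ> c"] by (simp add: image_comp)
    finally have "c ` U \<in> I" using m by (auto simp: I_def)
    then show "c \<in> (\<Union>S\<in>I. ?onto S)" using c by (auto simp: PiE_def)
  qed (auto simp: I_def PiE_def)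
  then have "card {R. interval_order_on U R} = card (\<Union>S\<in>I. ?onto S)"
    using bij_betw_same_card[OF bij_betw_endpoints[OF U]] by simp
  also have "\<dots> = (\<Sum>S\<in>I. card (?onto S))"
  proof (rule card_UN_disjoint)
    show "\<forall>S\<in>I. finite (?onto S)"
    proof
      fix S assume "S \<in> I"
      then have "finite (U \<rightarrow>\<^sub>E S)" using finS by (intro finite_PiE U) (auto simp: I_def)
      then show "finite (?onto S)" by (rule finite_subset[rotated]) auto
    qed
  qed (use fin in \<open>auto simp: I_def\<close>)
  also have "\<dots> = (\<Sum>m\<le>card U. \<Sum>S\<in>row_col_full m. card (?onto S))"
    unfolding I_def
  proof (rule sum.UNION_disjoint)
    show "\<forall>i\<in>{..card U}. \<forall>j\<in>{..card U}. i \<noteq> j \<longrightarrow> row_col_full i \<inter> row_col_full j = {}"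
      by (auto simp: row_col_full_def)
  qed (use fin in auto)
  also have "real \<dots> = (\<Sum>m\<le>card U. \<Sum>S\<in>row_col_full m. fact (card U) * ((fps_exp 1 - 1) ^ card S) $ card U)"
    using card_maps_onto[OF U finS] by (simp cong: sum.cong)
  also have "\<dots> = fact (card U) * lsum (\<lambda>m. \<Sum>S\<in>row_col_full m. (fps_exp 1 - 1) ^ card S) $ card U"
    by (simp only: lsum_nth fps_sum_nth sum_distrib_left)
  finally show ?thesis by (simp only: lsum_row_col_full)
qed

section \<open>Zagier's identity\<close>

definition polynomial_coeffs :: "(real \<Rightarrow> real fps) \<Rightarrow> bool" where
  "polynomial_coeffs f \<longleftrightarrow> (\<forall>k. \<exists>p. \<forall>j. f j $ k = poly p j)"

lemma polynomial_coeffs_const: "polynomial_coeffs (\<lambda>_. c)"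
  unfolding polynomial_coeffs_def
proof
  fix k show "\<exists>p. \<forall>j::real. c $ k = poly p j" by (rule exI[of _ "[:c $ k:]"]) simp
qed

lemma sum_eq_poly:
  assumes "\<And>i. i \<in> I \<Longrightarrow> \<exists>p. \<forall>j::real. f i j = poly p j"
  shows "\<exists>p. \<forall>j. (\<Sum>i\<in>I. f i j) = poly p j"
proof -
  obtain p where "\<And>i j. i \<in> I \<Longrightarrow> f i j = poly (p i) j" using assms by metis
  then have "\<forall>j. (\<Sum>i\<in>I. f i j) = poly (\<Sum>i\<in>I. p i) j" by (simp add: poly_sum)
  then show ?thesis by blast
qed

lemma polynomial_coeffs_diff:
  assumes "polynomial_coeffs f" "polynomial_coeffs g" shows "polynomial_coeffs (\<lambda>j. f j - g j)"
  unfolding polynomial_coeffs_def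
proof
  fix k
  from assms obtain p q where "\<And>j. f j $ k = poly p j" "\<And>j. g j $ k = poly q j"
    unfolding polynomial_coeffs_def by metis
  then show "\<exists>p. \<forall>j. (f j - g j) $ k = poly p j" by (intro exI[of _ "p - q"]) simp
qed

lemma polynomial_coeffs_mult:
  assumes "polynomial_coeffs f" "polynomial_coeffs g" shows "polynomial_coeffs (\<lambda>j. f j * g j)"
  unfolding polynomial_coeffs_def fps_mult_nth
proof (intro allI sum_eq_poly)
  fix k i
  from assms obtain p q where "\<And>j. f j $ i = poly p j" "\<And>j. g j $ (k - i) = poly q j"
    unfolding polynomial_coeffs_def by metis
  then show "\<exists>p. \<forall>j. f j $ i * g j $ (k - i) = poly p j" by (intro exI[of _ "p * q"]) simp
qed

lemma polynomial_coeffs_prod: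
  assumes "\<And>i. polynomial_coeffs (f i)" shows "polynomial_coeffs (\<lambda>j. \<Prod>i\<in>I. f i j)"
  by (induction I rule: infinite_finite_induct)
    (simp_all add: polynomial_coeffs_const polynomial_coeffs_mult assms)

lemma polynomial_coeffs_lsum:
  assumes "\<And>m. polynomial_coeffs (\<lambda>j. f j m)" shows "polynomial_coeffs (\<lambda>j. lsum (f j))"
  unfolding polynomial_coeffs_def lsum_nth
  using assms by (intro allI sum_eq_poly) (simp add: polynomial_coeffs_def)

lemma polynomial_coeffs_exp: "polynomial_coeffs (\<lambda>j. fps_exp (poly p j))"
  unfolding polynomial_coeffs_def
proof
  fix k
  have "\<forall>j. fps_exp (poly p j) $ k = poly (smult (1 / fact k) (p ^ k)) j" by simp
  then show "\<exists>q. \<forall>j. fps_exp (poly p j) $ k = poly q j" by blast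
qed

lemma polynomial_coeffs_exp_affine: "polynomial_coeffs (\<lambda>j. fps_exp (a * j + b))"
  using polynomial_coeffs_exp[of "[:b, a:]"] by (simp add: algebra_simps)

text \<open>
  Shifting the argument keeps the leading coefficient, which is therefore its own negative.
\<close>

lemma poly_alternating_eq_0:
  fixes p :: "real poly"
  assumes "\<And>x. poly p x + poly p (x + 1) = 0"
  shows "p = 0"
proof -
  have "poly (pcompose p [:1, 1:]) x = poly (- p) x" for x
    using assms[of x] by (simp add: poly_pcompose add.commute)
  then have "pcompose p [:1, 1:] = - p" by (intro poly_eq_poly_eq_iff[THEN iffD1] ext)
  then have "lead_coeff p = - lead_coeff p"
    using lead_coeff_comp[of "[:1, 1:]" p] by simp
  then show ?thesis by simp
qed

definition zagier_prod :: "real \<Rightarrow> nat \<Rightarrow> real fps" where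
  "zagier_prod j m = (\<Prod>i=1..m. 1 - fps_exp (- (j + real i)))"

text \<open>
  With \<open>q = exp (- t)\<close> and \<open>x = q\<^sup>j\<close> this is \<open>\<Sum>\<^sub>m x\<^sup>m (1 - xq) \<dots> (1 - xq\<^sup>m)\<close>.  The factor \<open>1 - x\<close> of \<open>S(x)\<close> is
  kept apart because it vanishes at \<open>j = 0\<close>.
\<close>

definition zagier_sum :: "real \<Rightarrow> real fps" where
  "zagier_sum j = lsum (\<lambda>m. fps_exp (- (j * real m)) * zagier_prod j m)"

lemma locally_finite_zagier_sum: "locally_finite (\<lambda>m. fps_exp (- (j * real m)) * zagier_prod j m)"
  unfolding zagier_prod_def by (intro locally_finite_cmult locally_finite_prod) simp

lemma fps_exp_mult_fps_exp: "fps_exp a * fps_exp b = fps_exp (a + b :: real)"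
  by (simp add: fps_exp_add_mult)

text \<open>
  The equation \<open>S(x) = 1 - qx\<^sup>2 - q\<^sup>2x\<^sup>3 S(qx)\<close> at \<open>x = q\<^sup>j\<close>.  If \<open>f m\<close> is the \<open>m\<close>-th term of the sum, the
  \<open>m\<close>-th term of \<open>q\<^sup>2x\<^sup>3 S(qx)\<close> is \<open>x f (m + 1) - f (m + 2)\<close>, so that \<open>S(qx)\<close> is again expressed by the
  sum of all \<open>f m\<close>.
\<close>

lemma zagier_sum_functional_equation:
  "(1 - fps_exp (- j)) * zagier_sum j =
     1 - fps_exp (- (2 * j + 1)) -
     fps_exp (- (3 * j + 2)) * ((1 - fps_exp (- (j + 1))) * zagier_sum (j + 1))"
proof -
  define f where "f m = fps_exp (- (j * real m)) * zagier_prod j m" for m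
  define x where "x = fps_exp (- j)"
  note lf = locally_finite_zagier_sum[of j, folded f_def]
  have tj: "zagier_sum j = lsum f" by (simp add: zagier_sum_def f_def[abs_def])
  have f0: "f 0 = 1" by (simp add: f_def zagier_prod_def)
  have shift: "(1 - fps_exp (- (j + 1))) * zagier_prod (j + 1) m = zagier_prod j (Suc m)" for m
  proof (induction m)
    case (Suc m)
    have "(1 - fps_exp (- (j + 1))) * zagier_prod (j + 1) (Suc m) =
        ((1 - fps_exp (- (j + 1))) * zagier_prod (j + 1) m) * (1 - fps_exp (- (j + 1 + real (Suc m))))"
      by (simp add: zagier_prod_def mult.assoc)
    also have "\<dots> = zagier_prod j (Suc (Suc m))"
      unfolding Suc by (simp add: zagier_prod_def ac_simps)
    finally show ?case .
  qed (simp add: zagier_prod_def)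
  have step: "fps_exp (- (3 * j + 2)) * ((1 - fps_exp (- (j + 1))) *
      (fps_exp (- ((j + 1) * real m)) * zagier_prod (j + 1) m)) = x * f (Suc m) - f (Suc (Suc m))" for m
  proof -
    have "zagier_prod j (Suc (Suc m)) = zagier_prod j (Suc m) * (1 - fps_exp (- (j + real m + 2)))"
      by (simp add: zagier_prod_def algebra_simps)
    then have "x * f (Suc m) - f (Suc (Suc m)) = x * (fps_exp (- (j * real (Suc m))) * zagier_prod j (Suc m)) -
        fps_exp (- (j * real (Suc (Suc m)))) * (zagier_prod j (Suc m) * (1 - fps_exp (- (j + real m + 2))))"
      by (simp only: f_def)
    also have "\<dots> = (x * fps_exp (- (j * real (Suc m)))
        - fps_exp (- (j * real (Suc (Suc m)))) * (1 - fps_exp (- (j + real m + 2)))) * zagier_prod j (Suc m)"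
      by (simp only: left_diff_distrib right_diff_distrib mult_ac)
    also have "x * fps_exp (- (j * real (Suc m))) = fps_exp (- (j * real (Suc (Suc m))))"
      by (simp add: x_def fps_exp_mult_fps_exp algebra_simps)
    also have "\<dots> - \<dots> * (1 - fps_exp (- (j + real m + 2))) =
        fps_exp (- (j * real (Suc (Suc m)))) * fps_exp (- (j + real m + 2))"
      by (simp add: algebra_simps)
    also have "\<dots> = fps_exp (- (3 * j + 2)) * fps_exp (- ((j + 1) * real m))"
      unfolding fps_exp_mult_fps_exp by (simp add: algebra_simps)
    finally show ?thesis by (simp add: shift[symmetric] ac_simps)
  qed
  have "fps_exp (- (3 * j + 2)) * ((1 - fps_exp (- (j + 1))) * zagier_sum (j + 1)) =
      lsum (\<lambda>m. x * f (Suc m) - f (Suc (Suc m)))"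
    unfolding zagier_sum_def step[symmetric]
    by (simp only: lsum_cmult locally_finite_zagier_sum locally_finite_cmult)
  also have "\<dots> = x * lsum (\<lambda>m. f (Suc m)) - lsum (\<lambda>m. f (Suc (Suc m)))"
    by (simp add: lsum_diff lsum_cmult locally_finite_Suc lf)
  also have "lsum (\<lambda>m. f (Suc m)) = lsum f - 1"
    using lsum_rec[OF lf] f0 by simp
  also have "lsum (\<lambda>m. f (Suc (Suc m))) = lsum f - 1 - f 1"
    using lsum_rec[OF lf] lsum_rec[OF locally_finite_Suc[OF lf]] f0 by simp
  also have "f 1 = x - fps_exp (- (2 * j + 1))"
    by (simp add: f_def zagier_prod_def x_def right_diff_distrib fps_exp_mult_fps_exp)
  finally show ?thesis
    by (simp add: tj x_def algebra_simps)
qed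

text \<open>
  The prefactor turns the quadratic exponents of \<open>q\<close> into squares, since
  \<open>(6j + 7)\<^sup>2 - (6j + 1)\<^sup>2 = 24 (3j + 2)\<close> and \<open>(6j + 5)\<^sup>2 - (6j + 1)\<^sup>2 = 24 (2j + 1)\<close>; the equation then
  has coefficient 1 at both values of \<open>j\<close>.
\<close>

definition completed_zagier_sum :: "real \<Rightarrow> real fps" where
  "completed_zagier_sum j = fps_exp (- ((6 * j + 1)\<^sup>2 / 24)) * zagier_sum j"

lemma completed_zagier_sum_functional_equation:
  "(1 - fps_exp (- j)) * completed_zagier_sum j + (1 - fps_exp (- (j + 1))) * completed_zagier_sum (j + 1) =
     fps_exp (- ((6 * j + 1)\<^sup>2 / 24)) - fps_exp (- ((6 * j + 5)\<^sup>2 / 24))"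
proof -
  have "(1 - fps_exp (- j)) * completed_zagier_sum j =
      fps_exp (- ((6 * j + 1)\<^sup>2 / 24)) * ((1 - fps_exp (- j)) * zagier_sum j)"
    by (simp add: completed_zagier_sum_def ac_simps)
  also have "\<dots> = fps_exp (- ((6 * j + 1)\<^sup>2 / 24)) -
      fps_exp (- ((6 * j + 1)\<^sup>2 / 24)) * fps_exp (- (2 * j + 1)) -
      fps_exp (- ((6 * j + 1)\<^sup>2 / 24)) * fps_exp (- (3 * j + 2)) *
         ((1 - fps_exp (- (j + 1))) * zagier_sum (j + 1))"
    by (subst zagier_sum_functional_equation) (simp add: algebra_simps)
  also have "fps_exp (- ((6 * j + 1)\<^sup>2 / 24)) * fps_exp (- (2 * j + 1)) = fps_exp (- ((6 * j + 5)\<^sup>2 / 24))"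
    by (simp add: fps_exp_mult_fps_exp power2_eq_square field_simps)
  also have "fps_exp (- ((6 * j + 1)\<^sup>2 / 24)) * fps_exp (- (3 * j + 2)) = fps_exp (- ((6 * (j + 1) + 1)\<^sup>2 / 24))"
    by (simp add: fps_exp_mult_fps_exp power2_eq_square field_simps)
  finally show ?thesis
    by (simp add: completed_zagier_sum_def ac_simps)
qed

lemma polynomial_coeffs_completed_zagier_sum: "polynomial_coeffs completed_zagier_sum"
proof -
  have e: "polynomial_coeffs (\<lambda>j. fps_exp (- ((6 * j + 1)\<^sup>2 / 24)))"
    using polynomial_coeffs_exp[of "smult (- 1 / 24) ([:1, 6:] ^ 2)"] by (simp add: add.commute mult.commute)
  have x: "polynomial_coeffs (\<lambda>j. fps_exp (- (j * real m)))" for m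
    using polynomial_coeffs_exp_affine[of "- real m" 0] by (simp add: mult.commute)
  have "polynomial_coeffs (\<lambda>j. fps_exp (- (j + real i)))" for i
    using polynomial_coeffs_exp_affine[of "- 1" "- real i"] by simp
  then have "polynomial_coeffs (\<lambda>j. zagier_prod j m)" for m
    unfolding zagier_prod_def by (intro polynomial_coeffs_prod polynomial_coeffs_diff polynomial_coeffs_const)
  then show ?thesis unfolding completed_zagier_sum_def[abs_def] zagier_sum_def
    by (intro polynomial_coeffs_mult polynomial_coeffs_lsum e x)
qed

text \<open>
  At \<open>j = 0\<close> the factor \<open>1 - exp (- j t)\<close> vanishes and has derivative \<open>t\<close>.
\<close>

lemma DERIV_one_minus_exp_mult:
  assumes W: "polynomial_coeffs W"
  shows "((\<lambda>j. ((1 - fps_exp (- j)) * W j) $ Suc n) has_real_derivative W 0 $ n) (at 0)"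
proof -
  define u where "u i j = (1 - fps_exp (- j)) $ i" for i and j :: real
  have u0: "u i 0 = 0" for i by (simp add: u_def)
  have u': "(u i has_real_derivative (if i = 1 then 1 else 0)) (at 0)" for i
  proof (cases "i = 0")
    case True
    then show ?thesis by (simp add: u_def[abs_def])
  next
    case False
    then have "u i = (\<lambda>j. - ((- j) ^ i / fact i))" by (simp add: u_def fun_eq_iff)
    then show ?thesis using False
      by (auto intro!: derivative_eq_intros simp: power_0_left)
  qed
  have W': "\<exists>d. ((\<lambda>j. W j $ k) has_real_derivative d) (at 0)" for k
  proof -
    obtain p where "\<And>j. W j $ k = poly p j" using W unfolding polynomial_coeffs_def by metis
    then show ?thesis using poly_DERIV[of p 0] by (intro exI[of _ "poly (pderiv p) 0"]) simp
  qed
  have t: "((\<lambda>j. u i j * W j $ (Suc n - i)) has_real_derivative (if i = 1 then W 0 $ n else 0)) (at 0)" for i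
  proof -
    obtain d where "((\<lambda>j. W j $ (Suc n - i)) has_real_derivative d) (at 0)" using W' by blast
    from DERIV_mult[OF u' this] show ?thesis
      by (rule DERIV_cong) (simp add: u0)
  qed
  have "((\<lambda>j. \<Sum>i=0..Suc n. u i j * W j $ (Suc n - i)) has_real_derivative
      (\<Sum>i=0..Suc n. if i = 1 then W 0 $ n else 0)) (at 0)"
    by (intro DERIV_sum t)
  moreover have "(\<Sum>i=0..Suc n. if i = 1 then W 0 $ n else 0) = W 0 $ n"
    by (subst sum.delta) auto
  ultimately show ?thesis by (simp only: u_def fps_mult_nth)
qed

text \<open>
  The even primitive character \<open>\<chi>\<close> modulo 12 is 1 at 1 and 11, and -1 at 5 and 7.  As
  \<open>exp y - exp (5 y)\<close> runs over half a period and \<open>\<chi>(n + 6) = - \<chi>(n)\<close>, this is the regularized value of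
  \<open>\<Sum>\<^sub>n \<chi>(n) exp (n y)\<close>.
\<close>

definition chi_series :: "real fps" where
  "chi_series = (fps_exp 1 - fps_exp 5) / (1 + fps_exp 6)"

lemma chi_series_mult: "chi_series * (1 + fps_exp 6) = fps_exp 1 - fps_exp 5"
  unfolding chi_series_def
proof -
  have "is_unit (1 + fps_exp 6 :: real fps)" by (simp add: fps_is_unit_iff)
  then show "(fps_exp 1 - fps_exp 5) / (1 + fps_exp 6) * (1 + fps_exp 6) = (fps_exp 1 - fps_exp 5 :: real fps)"
    by (rule unit_div_mult_self)
qed

text \<open>
  The regularized value of \<open>\<Sum>\<^sub>m \<chi>(m) (m + z)\<^sup>n\<close>.
\<close>

definition chi_poly :: "nat \<Rightarrow> real \<Rightarrow> real" where
  "chi_poly n z = fact n * (fps_exp z * chi_series) $ n"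

lemma chi_poly_functional_equation:
  "chi_poly n z + chi_poly n (z + 6) = (z + 1) ^ n - (z + 5) ^ n"
proof -
  have "fps_exp z * chi_series + fps_exp (z + 6) * chi_series =
      fps_exp z * (chi_series * (1 + fps_exp 6))"
    by (simp add: fps_exp_add_mult algebra_simps)
  also have "\<dots> = fps_exp (z + 1) - fps_exp (z + 5)"
    unfolding chi_series_mult by (simp add: fps_exp_add_mult algebra_simps)
  finally have "(fps_exp z * chi_series) $ n + (fps_exp (z + 6) * chi_series) $ n
      = fps_exp (z + 1) $ n - fps_exp (z + 5) $ n"
    by (metis fps_add_nth fps_sub_nth)
  then show ?thesis
    unfolding chi_poly_def distrib_left[symmetric] by (simp add: field_simps)
qed

lemma chi_poly_eq_poly: "\<exists>p. \<forall>z. chi_poly n z = poly p z"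
proof -
  have "polynomial_coeffs (\<lambda>z. fps_exp z * chi_series)"
    using polynomial_coeffs_exp_affine[of 1 0] by (intro polynomial_coeffs_mult polynomial_coeffs_const) simp
  then obtain p where "\<And>z. (fps_exp z * chi_series) $ n = poly p z"
    unfolding polynomial_coeffs_def by metis
  then show ?thesis by (intro exI[of _ "smult (fact n) p"]) (simp add: chi_poly_def)
qed

lemma DERIV_chi_poly: "(chi_poly (Suc n) has_real_derivative fact (Suc n) * chi_series $ n) (at 0)"
proof -
  have t: "((\<lambda>z. fps_exp z $ i * chi_series $ (Suc n - i)) has_real_derivative
      (if i = 1 then chi_series $ n else 0)) (at (0::real))" for i
  proof (cases "i = 0")
    case False
    then show ?thesis by (auto intro!: derivative_eq_intros simp: power_0_left)
  qed simp
  have "((\<lambda>z::real. \<Sum>i=0..Suc n. fps_exp z $ i * chi_series $ (Suc n - i)) has_real_derivative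
      (\<Sum>i=0..Suc n. if i = 1 then chi_series $ n else 0)) (at 0)"
    by (intro DERIV_sum t)
  moreover have "(\<Sum>i=0..Suc n. if i = 1 then chi_series $ n else 0) = chi_series $ n"
    by (subst sum.delta) auto
  ultimately have "((\<lambda>z. (fps_exp z * chi_series) $ Suc n) has_real_derivative chi_series $ n) (at (0::real))"
    by (simp only: fps_mult_nth)
  then show ?thesis unfolding chi_poly_def[abs_def] by (rule DERIV_cmult)
qed

text \<open>
  Both sides are polynomials in \<open>j\<close>, and adding the value at \<open>j + 1\<close> to the value at \<open>j\<close> gives the same
  result for both, so their difference alternates in sign under \<open>j \<mapsto> j + 1\<close>.
\<close>

lemma completed_zagier_sum_nth:
  "((1 - fps_exp (- j)) * completed_zagier_sum j) $ k = (-1 / 24) ^ k / fact k * chi_poly (2 * k) (6 * j)"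
proof -
  have "polynomial_coeffs (\<lambda>j. (1 - fps_exp (- j)) * completed_zagier_sum j)"
    using polynomial_coeffs_exp_affine[of "-1" 0] polynomial_coeffs_completed_zagier_sum
    by (intro polynomial_coeffs_mult polynomial_coeffs_diff polynomial_coeffs_const) simp_all
  then obtain p where p: "\<And>j. ((1 - fps_exp (- j)) * completed_zagier_sum j) $ k = poly p j"
    unfolding polynomial_coeffs_def by metis
  obtain q where q: "\<And>z. chi_poly (2 * k) z = poly q z" using chi_poly_eq_poly by metis
  define r where "r = p - smult ((-1 / 24) ^ k / fact k) (pcompose q [:0, 6:])"
  have r: "poly r j = ((1 - fps_exp (- j)) * completed_zagier_sum j) $ k -
      (-1 / 24) ^ k / fact k * chi_poly (2 * k) (6 * j)" for j
    unfolding p q by (simp add: r_def poly_pcompose mult.commute)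
  have "poly r j + poly r (j + 1) = 0" for j
  proof -
    have "((1 - fps_exp (- j)) * completed_zagier_sum j) $ k +
       ((1 - fps_exp (- (j + 1))) * completed_zagier_sum (j + 1)) $ k =
       fps_exp (- ((6 * j + 1)\<^sup>2 / 24)) $ k - fps_exp (- ((6 * j + 5)\<^sup>2 / 24)) $ k"
      unfolding fps_add_nth[symmetric] completed_zagier_sum_functional_equation by simp
    also have "\<dots> = (-1 / 24) ^ k / fact k * ((6 * j + 1) ^ (2 * k) - (6 * j + 5) ^ (2 * k))"
    proof -
      have "(- (a\<^sup>2 / 24)) ^ k = (-1 / 24) ^ k * a ^ (2 * k)" for a :: real
        by (simp add: power_mult flip: power_mult_distrib)
      then show ?thesis by (simp add: field_simps)
    qed
    also have "(6 * j + 1) ^ (2 * k) - (6 * j + 5) ^ (2 * k) =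
        chi_poly (2 * k) (6 * j) + chi_poly (2 * k) (6 * (j + 1))"
      using chi_poly_functional_equation[of "2 * k" "6 * j"] by (simp add: algebra_simps)
    finally show ?thesis unfolding r by (simp add: algebra_simps)
  qed
  then have "r = 0" by (rule poly_alternating_eq_0)
  then show ?thesis using r[of j] by simp
qed

text \<open>
  The substitution \<open>y \<mapsto> c y\<close>, a ring homomorphism; \<open>c = \<i>\<close> turns hyperbolic functions into
  trigonometric ones.
\<close>

definition twist :: "complex \<Rightarrow> real fps \<Rightarrow> complex fps" where
  "twist c f = Abs_fps (\<lambda>n. c ^ n * of_real (f $ n))"

lemma twist_mult: "twist c (f * g) = twist c f * twist c g"
proof (rule fps_ext)
  fix n
  have "twist c (f * g) $ n = (\<Sum>i=0..n. c ^ n * (of_real (f $ i) * of_real (g $ (n - i))))"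
    by (simp add: twist_def fps_mult_nth sum_distrib_left)
  also have "\<dots> = (\<Sum>i=0..n. (c ^ i * of_real (f $ i)) * (c ^ (n - i) * of_real (g $ (n - i))))"
  proof (rule sum.cong)
    fix i assume "i \<in> {0..n}"
    then have "c ^ n = c ^ i * c ^ (n - i)" by (simp flip: power_add)
    then show "c ^ n * (of_real (f $ i) * of_real (g $ (n - i))) =
      (c ^ i * of_real (f $ i)) * (c ^ (n - i) * of_real (g $ (n - i)))" by simp
  qed simp
  finally show "twist c (f * g) $ n = (twist c f * twist c g) $ n"
    by (simp add: twist_def fps_mult_nth)
qed

lemma twist_add: "twist c (f + g) = twist c f + twist c g"
  by (rule fps_ext) (simp add: twist_def algebra_simps)

lemma twist_diff: "twist c (f - g) = twist c f - twist c g"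
  by (rule fps_ext) (simp add: twist_def algebra_simps)

lemma twist_exp: "twist c (fps_exp a) = fps_exp (c * of_real a)"
  by (rule fps_ext) (simp add: twist_def power_mult_distrib)

text \<open>
  Multiplying numerator and denominator by \<open>exp (- 3 y)\<close> shows that the series is \<open>- sinh 2y / cosh 3y\<close>, and
  at \<open>y = \<i> x\<close> this is \<open>- 2 \<i>\<close> times the defining series of the T-numbers.
\<close>

lemma chi_series_odd: "chi_series $ (2 * n + 1) = - 2 * (-1) ^ n * glaisher_T n / fact (2 * n + 1)"
proof -
  define H where "H = (fps_sin 2 / (2 * fps_cos 3) :: real fps)"
  have "is_unit (2 * fps_cos 3 :: real fps)" by (simp add: fps_is_unit_iff)
  then have H: "H * (2 * fps_cos 3) = fps_sin 2" by (simp add: H_def)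
  have s: "twist 1 (fps_sin 2) = fps_sin 2" "twist 1 (2 * fps_cos 3) = 2 * fps_cos 3"
    by (auto intro!: fps_ext simp: twist_def fps_sin_def fps_cos_def numeral_fps_const)
  have Hc: "twist 1 H * (2 * fps_cos 3) = fps_sin 2"
    using arg_cong[OF H, of "twist 1"] by (simp only: twist_mult[of 1 H] s)
  have "chi_series * (fps_exp (-3) + fps_exp 3) = fps_exp (-3) * (chi_series * (1 + fps_exp 6))"
    by (simp add: algebra_simps flip: fps_exp_add_mult)
  also have "\<dots> = fps_exp (-2) - fps_exp 2"
    unfolding chi_series_mult by (simp add: algebra_simps flip: fps_exp_add_mult)
  finally have "twist \<i> (chi_series * (fps_exp (-3) + fps_exp 3)) = twist \<i> (fps_exp (-2) - fps_exp 2)"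
    by simp
  then have "twist \<i> chi_series * (fps_exp (- (\<i> * 3)) + fps_exp (\<i> * 3)) = fps_exp (- (\<i> * 2)) - fps_exp (\<i> * 2)"
    by (simp add: twist_mult twist_add twist_diff twist_exp)
  then have "twist \<i> chi_series * (2 * fps_cos 3) = - 2 * fps_const \<i> * fps_sin 2"
    by (simp only: fps_exp_ii_sin_cos fps_exp_minus_ii_sin_cos) (simp add: algebra_simps)
  also have "\<dots> = (- 2 * fps_const \<i> * twist 1 H) * (2 * fps_cos 3)"
    by (simp add: Hc[symmetric] mult.assoc)
  finally have K: "twist \<i> chi_series = - 2 * fps_const \<i> * twist 1 H"
  proof (rule mult_right_cancel[THEN iffD1, rotated])
    show "(2 * fps_cos 3 :: complex fps) \<noteq> 0"
      by (metis fps_cos_nth_0 fps_zero_nth mult_eq_0_iff zero_neq_numeral zero_neq_one)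
  qed
  have "\<i> * ((-1) ^ n * of_real (chi_series $ (2 * n + 1))) = twist \<i> chi_series $ (2 * n + 1)"
    by (simp add: twist_def power_mult)
  also have "\<dots> = - (2 * \<i> * of_real (H $ (2 * n + 1)))"
    unfolding K by (simp add: twist_def mult.assoc numeral_fps_const)
  finally have "\<i> * of_real ((-1) ^ n * chi_series $ (2 * n + 1)) = \<i> * of_real (- 2 * H $ (2 * n + 1))"
    by simp
  then have "(-1) ^ n * chi_series $ (2 * n + 1) = - 2 * H $ (2 * n + 1)"
    by (simp only: mult_cancel_left of_real_eq_iff) simp
  then have "(-1) ^ n * ((-1) ^ n * chi_series $ (2 * n + 1)) = (-1) ^ n * (- 2 * H $ (2 * n + 1))"
    by simp
  then have "chi_series $ (2 * n + 1) = - 2 * (-1) ^ n * H $ (2 * n + 1)"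
    by (simp flip: mult.assoc power_mult_distrib)
  then show ?thesis by (simp add: glaisher_T_def H_def)
qed

text \<open>
  Compare the derivatives at \<open>j = 0\<close> of the two expressions for the coefficients of
  \<open>completed_zagier_sum\<close> times \<open>1 - q\<^sup>j\<close>.
\<close>

theorem zagier_identity:
  "(fps_exp (- 1 / 24) * lsum (\<lambda>m. \<Prod>i=1..m. 1 - fps_exp (- real i))) $ n =
     glaisher_T n / (24 ^ n * fact n)"
proof -
  have 0: "completed_zagier_sum 0 = fps_exp (- 1 / 24) * lsum (\<lambda>m. \<Prod>i=1..m. 1 - fps_exp (- real i))"
    by (simp add: completed_zagier_sum_def zagier_sum_def zagier_prod_def)
  have "((\<lambda>j. ((1 - fps_exp (- j)) * completed_zagier_sum j) $ Suc n) has_real_derivative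
      (-1 / 24) ^ Suc n / fact (Suc n) * (6 * (fact (2 * n + 2) * chi_series $ (2 * n + 1)))) (at 0)"
  proof -
    have d: "(chi_poly (2 * n + 2) has_real_derivative fact (2 * n + 2) * chi_series $ (2 * n + 1)) (at 0)"
      using DERIV_chi_poly[of "2 * n + 1"] by simp
    have "((\<lambda>j. chi_poly (2 * n + 2) (6 * j)) has_real_derivative
        fact (2 * n + 2) * chi_series $ (2 * n + 1) * 6) (at 0)"
      by (rule DERIV_chain2[where g = "\<lambda>j. 6 * j"]) (use d in \<open>auto intro!: derivative_eq_intros\<close>)
    moreover have "((1 - fps_exp (- j)) * completed_zagier_sum j) $ Suc n =
        (-1 / 24) ^ Suc n / fact (Suc n) * chi_poly (2 * n + 2) (6 * j)" for j
      by (subst completed_zagier_sum_nth) simp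
    ultimately show ?thesis
      by (simp only: DERIV_cmult mult.commute[of _ 6])
  qed
  then have "completed_zagier_sum 0 $ n =
      (-1 / 24) ^ Suc n / fact (Suc n) * (6 * (fact (2 * n + 2) * chi_series $ (2 * n + 1)))"
    by (rule DERIV_unique[OF DERIV_one_minus_exp_mult[OF polynomial_coeffs_completed_zagier_sum]])
  also have "chi_series $ (2 * n + 1) = - 2 * (-1) ^ n * glaisher_T n / fact (2 * n + 1)"
    by (rule chi_series_odd)
  \<comment> \<open>the factor \<open>2n + 2\<close> comes from the derivative of a polynomial of even degree, the factor 6 from
    its argument \<open>6j\<close>; their product with -2 and \<open>1 / (24 (n + 1))\<close> is -1\<close>
  also have "(fact (2 * n + 2) :: real) = 2 * (real n + 1) * fact (2 * n + 1)"
    by (simp add: algebra_simps)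
  also have "(-1 / 24) ^ Suc n / fact (Suc n) * (6 * (2 * (real n + 1) * fact (2 * n + 1) *
     (- 2 * (-1) ^ n * glaisher_T n / fact (2 * n + 1)))) = glaisher_T n / (24 ^ n * fact n)"
  proof -
    have "(-1 / 24 :: real) ^ Suc n = - ((-1) ^ n / 24 ^ Suc n)"
      using power_divide[of "-1 :: real" 24 "Suc n"] by (simp only: power_Suc)
    moreover have "(fact (Suc n) :: real) = (real n + 1) * fact n" by simp
    moreover have "real n + 1 \<noteq> 0" by linarith
    ultimately show ?thesis by (cases "even n") (simp_all add: divide_simps)
  qed
  finally show ?thesis unfolding 0 .
qed

section \<open>Splitting off isolated elements\<close>

lemma structures_T:
  "structures species_T U = {(R, \<chi>). interval_order_on U R \<and> \<chi> \<in> U \<rightarrow>\<^sub>E {1..24} \<and>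
     (\<forall>u\<in>U. isolated U R u \<longrightarrow> \<chi> u \<noteq> 24)}"
  unfolding structures.rep_eq[of species_T] species_T.rep_eq
  by (auto simp: structures_colored structures_interval_orders)

lemma transport_T: "transport species_T = transport (species_colored interval_orders 24)"
  unfolding transport.rep_eq[of species_T] species_T.rep_eq by simp

lemma interval_order_on_mono:
  "interval_order_on B R \<Longrightarrow> B \<subseteq> U \<Longrightarrow> interval_order_on U R"
  unfolding interval_order_on_def by blast

definition split_off :: "'u set \<Rightarrow> ('u \<times> 'u) set \<times> ('u \<Rightarrow> nat) \<Rightarrow>
    ('u set \<times> unit) \<times> ('u set \<times> (('u \<times> 'u) set \<times> ('u \<Rightarrow> nat)))" where
  "split_off U = (\<lambda>(R, \<chi>). let A = {u \<in> U. isolated U R u \<and> \<chi> u = 24} in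
     ((A, ()), (U - A, (R, restrict \<chi> (U - A)))))"

definition put_back :: "('u set \<times> unit) \<times> ('u set \<times> (('u \<times> 'u) set \<times> ('u \<Rightarrow> nat))) \<Rightarrow>
    ('u \<times> 'u) set \<times> ('u \<Rightarrow> nat)" where
  "put_back = (\<lambda>((A, _), (B, (R, \<chi>))). (R, \<lambda>u. if u \<in> A then 24 else \<chi> u))"

text \<open>
  Elements outside \<open>B\<close> take part in no relation, and relations inside \<open>B\<close> are not affected by them.
\<close>

lemma isolated_extend:
  assumes "R \<subseteq> B \<times> B" "B \<subseteq> U" "irrefl R"
  shows "isolated U R u \<longleftrightarrow> u \<notin> B \<or> isolated B R u"
  using assms by (auto simp: isolated_def irrefl_def)

lemma split_off_eq:
  "A = {u \<in> U. isolated U R u \<and> \<chi> u = 24} \<Longrightarrow>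
     split_off U (R, \<chi>) = ((A, ()), (U - A, (R, restrict \<chi> (U - A))))"
  by (simp add: split_off_def Let_def)

lemma split_off_in:
  assumes "(R, \<chi>) \<in> structures (species_colored interval_orders 24) U"
  shows "split_off U (R, \<chi>) \<in> structures (species_E \<cdot>\<^sub>S species_T) U"
proof -
  have R: "interval_order_on U R" and \<chi>: "\<chi> \<in> U \<rightarrow>\<^sub>E {1..24}"
    using assms by (auto simp: structures_colored structures_interval_orders)
  have irr: "irrefl R" and sub: "R \<subseteq> U \<times> U" using R by (auto simp: interval_order_on_def)
  define A where "A = {u \<in> U. isolated U R u \<and> \<chi> u = 24}"
  have RB: "R \<subseteq> (U - A) \<times> (U - A)"
    using sub irr by (auto simp: A_def isolated_def irrefl_def)
  have "interval_order_on (U - A) R" using R RB by (auto simp: interval_order_on_def)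
  moreover have "restrict \<chi> (U - A) \<in> (U - A) \<rightarrow>\<^sub>E {1..24}" using \<chi> by (auto simp: PiE_iff)
  moreover have "restrict \<chi> (U - A) u \<noteq> 24" if "u \<in> U - A" "isolated (U - A) R u" for u
  proof -
    have "isolated U R u" using isolated_extend[OF RB Diff_subset irr] that by blast
    then show ?thesis using that(1) by (auto simp: A_def)
  qed
  moreover have "split_off U (R, \<chi>) = ((A, ()), (U - A, (R, restrict \<chi> (U - A))))"
    by (rule split_off_eq) (simp add: A_def)
  moreover have "A \<subseteq> U" by (auto simp: A_def)
  ultimately show ?thesis
    by (auto simp: structures_prod structures_T)
qed

text \<open>
  The elements to be split off are recognized from the structure alone, so relabeling commutes with
  the decomposition.  In the other direction, an element put back is isolated and of color 24, while
  the remaining structure has no such element, so the two parts can be told apart again.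
\<close>

lemma colored_interval_orders_iso_E_times_T:
  "(species_colored interval_orders 24 :: ('u, ('u \<times> 'u) set \<times> ('u \<Rightarrow> nat)) species)
     \<cong>\<^sub>S species_E \<cdot>\<^sub>S species_T"
proof (rule nat_isoI)
  let ?I = "species_colored interval_orders 24 :: ('u, ('u \<times> 'u) set \<times> ('u \<Rightarrow> nat)) species"
  show "iso_witness ?I (species_E \<cdot>\<^sub>S species_T) split_off (\<lambda>_. put_back)"
    unfolding iso_witness_def
  proof (intro conjI allI impI ballI, goal_cases)
    case (1 U s)
    then show ?case using split_off_in by (cases s) blast
  next
    case (2 U s)
    then obtain R \<chi> where s: "s = (R, \<chi>)" "\<chi> \<in> U \<rightarrow>\<^sub>E {1..24}"
      by (cases s) (auto simp: structures_colored)
    then show ?case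
      by (auto simp: split_off_def put_back_def Let_def fun_eq_iff PiE_iff extensional_def)
  next
    case (3 U s)
    then obtain A B R \<chi> where s: "s = ((A, ()), (B, (R, \<chi>)))" "U = A \<union> B" "interval_order_on B R"
      "\<chi> \<in> B \<rightarrow>\<^sub>E {1..24}"
      by (cases s) (auto simp: structures_prod structures_T)
    then show ?case using interval_order_on_mono[OF s(3), of U]
      by (auto simp: put_back_def structures_colored structures_interval_orders PiE_iff extensional_def)
  next
    case (4 U s)
    then obtain A B R \<chi> where s: "s = ((A, ()), (B, (R, \<chi>)))" "U = A \<union> B" "A \<inter> B = {}"
      "interval_order_on B R" "\<chi> \<in> B \<rightarrow>\<^sub>E {1..24}" "\<forall>u\<in>B. isolated B R u \<longrightarrow> \<chi> u \<noteq> 24"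
      by (cases s) (auto simp: structures_prod structures_T)
    let ?\<chi> = "\<lambda>u. if u \<in> A then 24 else \<chi> u"
    have "R \<subseteq> B \<times> B" "irrefl R" using s(4) by (auto simp: interval_order_on_def)
    then have iso: "isolated U R u \<longleftrightarrow> u \<notin> B \<or> isolated B R u" for u
      using s(2) by (intro isolated_extend) auto
    have UAB: "u \<in> U \<longleftrightarrow> u \<in> A \<or> u \<in> B" for u using s(2) by simp
    have A: "{u \<in> U. isolated U R u \<and> ?\<chi> u = 24} = A"
      using s(3,6) by (auto simp: iso UAB)
    have B: "U - A = B" using s(2,3) by auto
    have "restrict ?\<chi> B = \<chi>"
      using s(3,5) by (auto simp: fun_eq_iff PiE_iff extensional_def)
    then show ?case unfolding s(1) put_back_def split_off_def by (simp only: Let_def split A B)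
  next
    case (5 U f s)
    obtain R \<chi> where s: "s = (R, \<chi>)" by (cases s)
    have R: "R \<subseteq> U \<times> U" using 5 s
      by (auto simp: structures_colored structures_interval_orders interval_order_on_def)
    note inj = 5(2)
    have iff: "(f u, f v) \<in> map_prod f f ` R \<longleftrightarrow> (u, v) \<in> R" if "u \<in> U" "v \<in> U" for u v
    proof
      assume "(f u, f v) \<in> map_prod f f ` R"
      then obtain p q where "(p, q) \<in> R" "f u = f p" "f v = f q" by auto
      then show "(u, v) \<in> R" using R that inj by (metis SigmaD1 SigmaD2 inj_onD subsetD)
    qed force
    have iso: "isolated (f ` U) (map_prod f f ` R) (f u) \<longleftrightarrow> isolated U R u" if u: "u \<in> U" for u
    proof -
      have "f ` U - {f u} = f ` (U - {u})" using inj u by (auto dest: inj_onD)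
      then show ?thesis using iff u by (simp add: isolated_def)
    qed
    let ?\<chi> = "restrict (\<lambda>v. \<chi> (inv_into U f v)) (f ` U)"
    define A where "A = {u \<in> U. isolated U R u \<and> \<chi> u = 24}"
    have A: "{v \<in> f ` U. isolated (f ` U) (map_prod f f ` R) v \<and> ?\<chi> v = 24} = f ` A"
      using inj iso by (auto simp: A_def dest: inj_onD)
    have B: "f ` U - f ` A = f ` (U - A)" using inj by (auto simp: A_def dest: inj_onD)
    have injB: "inj_on f (U - A)" using inj by (rule inj_on_subset) auto
    have \<chi>: "restrict ?\<chi> (f ` (U - A)) = restrict (\<lambda>v. restrict \<chi> (U - A) (inv_into (U - A) f v)) (f ` (U - A))"
      using inj injB by (auto simp: fun_eq_iff)
    have "split_off (f ` U) (map_prod f f ` R, ?\<chi>) =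
        ((f ` A, ()), (f ` (U - A), (map_prod f f ` R, restrict ?\<chi> (f ` (U - A)))))"
      using split_off_eq[OF A[symmetric]] by (simp only: B)
    moreover have "split_off U s = ((A, ()), (U - A, (R, restrict \<chi> (U - A))))"
      unfolding s by (rule split_off_eq) (simp add: A_def)
    ultimately show ?case
      by (simp add: s transport_T \<chi> del: restrict_restrict)
  qed
qed

text \<open>
  A bijection of the label sets induces, by transport, one of the sets of structures.
\<close>

lemma card_structures_cong:
  assumes "finite A" "finite B" "card A = card B"
  shows "card (structures F A) = card (structures F B)"
proof -
  obtain f where f: "bij_betw f A B" using finite_same_card_bij[OF assms] by blast
  then have inj: "inj_on f A" and B: "B = f ` A" by (auto simp: bij_betw_def)
  have "inj_on (transport F A f) (structures F A)"
    by (rule inj_on_inverseI) (rule transport_inv[OF assms(1) inj])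
  then show ?thesis unfolding B transport_image[OF assms(1) inj, symmetric] by (simp add: card_image)
qed

lemma card_structures_nat_iso:
  "F \<cong>\<^sub>S G \<Longrightarrow> finite U \<Longrightarrow> card (structures F U) = card (structures G U)"
  unfolding nat_iso_def by (blast intro: bij_betw_same_card)

lemma card_structures_E_prod:
  fixes F :: "(nat, 's) species"
  shows "card (structures (species_E \<cdot>\<^sub>S F) {1..n}) = (\<Sum>k\<le>n. (n choose k) * card (structures F {1..k}))"
proof -
  let ?U = "{1..n}"
  have "bij_betw (\<lambda>(B, s). ((?U - B, ()), (B, s))) (SIGMA B:Pow ?U. structures F B) (structures (species_E \<cdot>\<^sub>S F) ?U)"
    by (rule bij_betw_byWitness[where f' = "\<lambda>((A, _), (B, s)). (B, s)"]) (auto simp: structures_prod)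
  then have "card (structures (species_E \<cdot>\<^sub>S F) ?U) = card (SIGMA B:Pow ?U. structures F B)"
    by (rule bij_betw_same_card[symmetric])
  also have "\<dots> = (\<Sum>B\<in>Pow ?U. card (structures F B))"
    by (rule card_SigmaI) (auto intro: finite_structures finite_subset)
  also have "\<dots> = (\<Sum>B\<in>Pow ?U. card (structures F {1..card B}))"
    by (rule sum.cong) (auto intro!: card_structures_cong intro: finite_subset)
  also have "\<dots> = (\<Sum>k\<le>n. \<Sum>B\<in>{B \<in> Pow ?U. card B = k}. card (structures F {1..card B}))"
    by (rule sum.group[symmetric]) (auto intro: card_mono[of "{Suc 0..n}", simplified])
  also have "\<dots> = (\<Sum>k\<le>n. (n choose k) * card (structures F {1..k}))"
  proof (rule sum.cong)
    fix k
    have "card {B \<in> Pow ?U. card B = k} = n choose k"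
      using n_subsets[of ?U k] by (simp add: Pow_def Collect_conj_eq)
    then show "(\<Sum>B\<in>{B \<in> Pow ?U. card B = k}. card (structures F {1..card B})) =
      (n choose k) * card (structures F {1..k})" by simp
  qed simp
  finally show ?thesis .
qed

text \<open>
  Multiply Zagier's identity by \<open>exp (t / 24)\<close> and compare coefficients.
\<close>

lemma glaisher_T_binomial:
  "(\<Sum>k\<le>n. real (n choose k) * glaisher_T k) =
     24 ^ n * (fact n * lsum (\<lambda>m. \<Prod>i=1..m. 1 - fps_exp (- real i)) $ n)"
proof -
  let ?F = "lsum (\<lambda>m. \<Prod>i=1..m. 1 - fps_exp (- real i))"
  have "?F = (fps_exp (- 1 / 24) * ?F) * fps_exp (1 / 24)"
    using fps_exp_add_mult[of "- 1 / 24 :: real" "1 / 24"] by (simp add: mult.commute mult.left_commute)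
  then have "?F $ n = ((fps_exp (- 1 / 24) * ?F) * fps_exp (1 / 24)) $ n" by (rule arg_cong)
  also have "\<dots> = (\<Sum>k=0..n. (fps_exp (- 1 / 24) * ?F) $ k * fps_exp (1 / 24) $ (n - k))"
    by (rule fps_mult_nth)
  finally have "24 ^ n * (fact n * ?F $ n) =
      (\<Sum>k=0..n. 24 ^ n * (fact n * (glaisher_T k / (24 ^ k * fact k) * ((1 / 24) ^ (n - k) / fact (n - k)))))"
    by (simp only: zagier_identity fps_exp_nth sum_distrib_left of_nat_fact)
  also have "\<dots> = (\<Sum>k=0..n. real (n choose k) * glaisher_T k)"
  proof (rule sum.cong)
    fix k assume "k \<in> {0..n}"
    then have k: "k \<le> n" by simp
    then have "(24 :: real) ^ n = 24 ^ k * 24 ^ (n - k)" by (simp flip: power_add)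
    then show "24 ^ n * (fact n * (glaisher_T k / (24 ^ k * fact k) * ((1 / 24) ^ (n - k) / fact (n - k)))) =
      real (n choose k) * glaisher_T k"
      by (simp add: binomial_fact[OF k] power_one_over field_simps)
  qed simp
  finally show ?thesis by (simp add: atMost_atLeast0)
qed

lemma binomial_transform_inject:
  fixes f g :: "nat \<Rightarrow> real"
  assumes "\<And>n. (\<Sum>k\<le>n. real (n choose k) * f k) = (\<Sum>k\<le>n. real (n choose k) * g k)"
  shows "f n = g n"
proof (induction n rule: less_induct)
  case (less n)
  have "(\<Sum>k<n. real (n choose k) * f k) = (\<Sum>k<n. real (n choose k) * g k)"
    by (rule sum.cong) (use less in auto)
  then show ?case using assms[of n] by (simp flip: lessThan_Suc_atMost)
qed

lemma card_structures_T: "real (card (structures species_T {1..n::nat})) = glaisher_T n"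
proof (rule binomial_transform_inject)
  fix n
  let ?I = "species_colored interval_orders 24 :: (nat, (nat \<times> nat) set \<times> (nat \<Rightarrow> nat)) species"
  have "(\<Sum>k\<le>n. real (n choose k) * real (card (structures species_T {1..k}))) =
      real (card (structures (species_E \<cdot>\<^sub>S species_T) {1..n}))"
    by (simp only: card_structures_E_prod of_nat_sum of_nat_mult)
  also have "\<dots> = real (card (structures ?I {1..n}))"
    using card_structures_nat_iso[OF colored_interval_orders_iso_E_times_T, of "{1..n}"] by simp
  also have "\<dots> = 24 ^ n * real (card {R. interval_order_on {1..n} R})"
    by (simp add: structures_colored structures_interval_orders card_cartesian_product card_PiE)
  also have "\<dots> = (\<Sum>k\<le>n. real (n choose k) * glaisher_T k)"
    unfolding glaisher_T_binomial by (subst card_interval_orders) simp_all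
  finally show "(\<Sum>k\<le>n. real (n choose k) * real (card (structures species_T {1..k}))) =
    (\<Sum>k\<le>n. real (n choose k) * glaisher_T k)" .
qed

theorem theorem9p2:
  shows "(species_colored interval_orders 24 :: ('u, ('u \<times> 'u) set \<times> ('u \<Rightarrow> nat)) species)
           \<cong>\<^sub>S species_E \<cdot>\<^sub>S species_T \<and>
         (virt species_T :: 'u virt) = E_inverse * virt (species_colored interval_orders 24) \<and>
         (\<forall>n. real (card (structures species_T {1..n::nat})) = glaisher_T n)"
proof (intro conjI allI)
  have "virt (species_colored interval_orders 24) = virt species_E * (virt species_T :: 'u virt)"
    using colored_interval_orders_iso_E_times_T by (simp add: virt_eq_iff flip: virt_prod)
  then have "E_inverse * virt (species_colored interval_orders 24) =
      (virt species_E * E_inverse) * (virt species_T :: 'u virt)"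
    by (simp add: ac_simps)
  then show "(virt species_T :: 'u virt) = E_inverse * virt (species_colored interval_orders 24)"
    by (simp add: E_inverse)
qed (rule colored_interval_orders_iso_E_times_T card_structures_T)+

end
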